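(* There exists $\varepsilon_0\ge 1^\circ$ such that $h(n,T_0,\varepsilon)=h(n)$ for the equilateral triangle $T_0$, all $\varepsilon\in(0,\varepsilon_0)$ and all $n$, and such that for this $\varepsilon_0$ the following holds. Let $T$ be a triangle whose angles are between $60^\circ-\varepsilon_0/2$ and $60^\circ+\varepsilon_0/2$, and suppose that $0<\varepsilon<\varepsilon_0/2$. Then $h(n,T,\varepsilon)=h(n)$ for all $n$. In particular, $h(n,T,\varepsilon)=\frac{1}{24}(n^3-n)$ if $n$ is a power of $3$.
   Context: A triangle with angles $\alpha',\beta',\gamma'$ is called $\varepsilon$-similar to a triangle $T$ with angles $\alpha,\beta,\gamma$ if, for a suitable labelling of its angles, $|\alpha-\alpha'|<\varepsilon$, $|\beta-\beta'|<\varepsilon$ and $|\gamma-\gamma'|<\varepsilon$. Here $\varepsilon>0$ is an angle smaller than any angle of $T$. $h(n,T,\varepsilon)$ denotes the maximal number of triangles (3-element subsets) in a set of $n$ points in the plane that are $\varepsilon$-similar to $T$. The sequence $h(n)$ (one argument) is defined recursively by $h(0)=h(1)=h(2)=0$, $h(3)=1$, and for $n\ge 3$ $$h(n)=\max\{abc+h(a)+h(b)+h(c):\ a+b+c=n,\ a,b,c\ge 0 \text{ integers},\ a,b,c<n\}.$$ *)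

theory Defs
  imports "HOL-Analysis.Analysis"
begin

definition degrees :: "real \<Rightarrow> real" where
  "degrees x = x * pi / 180"

text \<open>The unoriented angle at the vertex \<open>B\<close>, in \<open>[0, pi]\<close>; only meaningful if
  \<open>A \<noteq> B\<close> and \<open>C \<noteq> B\<close>.\<close>

definition vangle :: "real^2 \<Rightarrow> real^2 \<Rightarrow> real^2 \<Rightarrow> real" where
  "vangle A B C = arccos (((A - B) \<bullet> (C - B)) / (norm (A - B) * norm (C - B)))"

text \<open>A triangle is represented by its set of vertices, so that a labelling of it is a choice
  of \<open>A\<close>, \<open>B\<close>, \<open>C\<close> with \<open>T = {A, B, C}\<close>.\<close>

definition is_triangle :: "(real^2) set \<Rightarrow> bool" where
  "is_triangle T \<longleftrightarrow> card T = 3 \<and> \<not> collinear T"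

definition triangle_angles :: "(real^2) set \<Rightarrow> real set" where
  "triangle_angles T = {vangle A B C | A B C. T = {A, B, C}}"

definition equilateral :: "(real^2) set \<Rightarrow> bool" where
  "equilateral T \<longleftrightarrow> is_triangle T \<and> (\<exists>s. \<forall>x\<in>T. \<forall>y\<in>T. x \<noteq> y \<longrightarrow> dist x y = s)"

definition eps_similar :: "real \<Rightarrow> (real^2) set \<Rightarrow> (real^2) set \<Rightarrow> bool" where
  "eps_similar \<epsilon> T' T \<longleftrightarrow> is_triangle T' \<and> is_triangle T \<and>
     (\<exists>A B C A' B' C'. T = {A, B, C} \<and> T' = {A', B', C'} \<and>
        \<bar>vangle B A C - vangle B' A' C'\<bar> < \<epsilon> \<and>
        \<bar>vangle A B C - vangle A' B' C'\<bar> < \<epsilon> \<and>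
        \<bar>vangle A C B - vangle A' C' B'\<bar> < \<epsilon>)"

definition num_similar :: "(real^2) set \<Rightarrow> (real^2) set \<Rightarrow> real \<Rightarrow> nat" where
  "num_similar P T \<epsilon> = card {S. S \<subseteq> P \<and> eps_similar \<epsilon> S T}"

text \<open>\<open>h(n, T, \<epsilon>)\<close>; intended for \<open>\<epsilon>\<close> positive and smaller than every angle of \<open>T\<close>.\<close>

definition h_sim :: "nat \<Rightarrow> (real^2) set \<Rightarrow> real \<Rightarrow> nat" where
  "h_sim n T \<epsilon> = Max {num_similar P T \<epsilon> | P. finite P \<and> card P = n}"

lemma h_sim_wf:
  "finite {num_similar P T \<epsilon> | P. finite P \<and> card P = n}"
  "{num_similar P T \<epsilon> | P. finite P \<and> card P = n} \<noteq> {}"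
proof -
  have "num_similar P T \<epsilon> \<le> 2 ^ n" if "finite P" "card P = n" for P
  proof -
    have "card {S. S \<subseteq> P \<and> eps_similar \<epsilon> S T} \<le> card (Pow P)"
      using that(1) by (intro card_mono) auto
    then show ?thesis
      using that by (simp add: num_similar_def card_Pow)
  qed
  then have "{num_similar P T \<epsilon> | P. finite P \<and> card P = n} \<subseteq> {..2 ^ n}"
    by auto
  then show "finite {num_similar P T \<epsilon> | P. finite P \<and> card P = n}"
    using finite_subset by blast
  have "infinite (UNIV :: (real^2) set)"
    using finite_imp_bounded not_bounded_UNIV by blast
  then obtain P :: "(real^2) set" where "finite P" "card P = n"
    using infinite_arbitrarily_large by blast
  then show "{num_similar P T \<epsilon> | P. finite P \<and> card P = n} \<noteq> {}"
    by blast
qed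

text \<open>The value \<open>h(3) = 1\<close> comes out of the recursion; see below.\<close>

function h_rec :: "nat \<Rightarrow> nat" where
  "h_rec n = (if n \<le> 2 then 0 else
     Max ((\<lambda>(a, b, c). a * b * c + h_rec a + h_rec b + h_rec c) `
        {(a, b, c). a + b + c = n \<and> a < n \<and> b < n \<and> c < n}))"
  by pat_completeness auto
termination
  by (relation "Wellfounded.measure id") auto

declare h_rec.simps [simp del]

lemma h_rec_wf:
  fixes n :: nat
  assumes "n \<ge> 3"
  shows "finite {(a, b, c). a + b + c = n \<and> a < n \<and> b < n \<and> c < n}"
    and "{(a, b, c). a + b + c = n \<and> a < n \<and> b < n \<and> c < n} \<noteq> {}"
proof -
  show "finite {(a, b, c). a + b + c = n \<and> a < n \<and> b < n \<and> c < n}"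
    by (rule finite_subset[of _ "{..n} \<times> {..n} \<times> {..n}"]) auto
  have "(1, 1, n - 2) \<in> {(a, b, c). a + b + c = n \<and> a < n \<and> b < n \<and> c < n}"
    using assms by auto
  then show "{(a, b, c). a + b + c = n \<and> a < n \<and> b < n \<and> c < n} \<noteq> {}"
    by blast
qed

lemma h_rec_small: "h_rec 0 = 0" "h_rec 1 = 0" "h_rec 2 = 0"
  by (simp_all add: h_rec.simps)

lemma h_rec_3: "h_rec 3 = 1"
proof -
  let ?S = "{(a, b, c). a + b + c = (3::nat) \<and> a < 3 \<and> b < 3 \<and> c < 3}"
  have h0: "h_rec a = 0" if "a < 3" for a
    using that by (simp add: h_rec.simps)
  have "(\<lambda>(a, b, c). a * b * c + h_rec a + h_rec b + h_rec c) ` ?S = {0, 1}" (is "?f ` _ = _")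
  proof
    have "a * b * c \<le> 1" if "a + b + c = 3" "a < 3" "b < 3" "c < 3" for a b c :: nat
    proof -
      have "a \<in> {0, 1, 2}" "b \<in> {0, 1, 2}" "c \<in> {0, 1, 2}"
        using that by auto
      then show ?thesis
        using that by auto
    qed
    then show "?f ` ?S \<subseteq> {0, 1}"
      using h0 by (fastforce simp: le_Suc_eq)
    have "?f (0, 1, 2) = 0" "?f (1, 1, 1) = 1" "(0, 1, 2) \<in> ?S" "(1, 1, 1) \<in> ?S"
      using h0 by auto
    then show "{0, 1} \<subseteq> ?f ` ?S"
      by (metis (no_types, lifting) empty_subsetI image_eqI insert_subset)
  qed
  then show ?thesis
    by (subst h_rec.simps) simp
qed

end

theory Submission
  imports Defs
begin

text \<open>
  All constants below are for the choice of one degree as the bound for \<open>\<epsilon>\<close>. Under either hypothesis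
  on the triangle, every \<open>\<epsilon>\<close>-similar triangle then has its three angles strictly between 59 and 61
  degrees, and it remains to show that \<open>n\<close> points span at most \<open>h_rec n\<close> such almost equilateral
  triangles and that \<open>h_rec n\<close> triangles \<open>\<epsilon>\<close>-similar to any given one can be attained.

  Upper bound. Give the points of a finite set positive integer weights, think of a point of weight
  \<open>k\<close> as a tiny cluster of \<open>k\<close> points that contains \<open>h_rec k\<close> triangles of its own, and count a
  triangle with the product of its weights. The claim is that the total count is at most \<open>h_rec\<close> of the
  total weight (\<open>recursive_bound\<close>); unit weights give the result. The proof is an induction on the number
  of points, with two cases.

  If two points lie in no common almost equilateral triangle, then the count is affine in the two
  weights while their sum is kept, so all of the weight may be moved to one of the two points
  (\<open>edge_weight_merge\<close>); the clusters lose nothing because \<open>h_rec\<close> is superadditive.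

  If every two points lie in a common almost equilateral triangle, then geometry shows that the set
  already looks like one step of the recursive construction (\<open>pair_covering_set_splits\<close>): it consists
  of three clusters, and each almost equilateral triangle lies in one cluster or has a vertex in
  each. Induction on the clusters, of weights \<open>a\<close>, \<open>b\<close>, \<open>c\<close>, then gives
  \<open>a * b * c + h_rec a + h_rec b + h_rec c\<close>.

  The clusters are found as follows. Let \<open>x\<close>, \<open>y\<close> be two points at maximal distance \<open>D\<close> and complete
  them to an almost equilateral triangle with \<open>z\<close>. For any point \<open>p\<close>, the pair \<open>x\<close>, \<open>p\<close> has a third
  vertex \<open>w\<close>, roughly \<open>p\<close> turned about \<open>x\<close> by 60 degrees. As \<open>w\<close> is within \<open>D\<close> of \<open>y\<close> and \<open>z\<close>, turning
  back puts \<open>p\<close> within about \<open>D\<close> of the mirror image of \<open>z\<close> in the line \<open>x y\<close> or of the mirror image of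
  \<open>y\<close> in the line \<open>x z\<close>. The same at \<open>y\<close> and \<open>z\<close> shows that \<open>p\<close> lies in two of the three discs of
  radius about \<open>D\<close> around the mirror images. Any two of these discs almost touch, and they do so at
  a vertex of the triangle, so \<open>p\<close> is near \<open>x\<close>, \<open>y\<close> or \<open>z\<close> (\<open>covered_point_near_vertex\<close>).

  Lower bound. Replace the vertices of the given triangle by small homothetic copies of optimal sets
  for \<open>a\<close>, \<open>b\<close>, \<open>c\<close> (\<open>h_rec_le_num_similar\<close>). For powers of three the recursion is solved by the inequality
  \<open>24 a b c + a\<^sup>3 + b\<^sup>3 + c\<^sup>3 \<le> (a + b + c)\<^sup>3\<close>, an equality for \<open>a = b = c\<close>.
\<close>

section \<open>The recursion\<close>

lemma h_rec_ge:
  assumes "a + b + c = n" "a < n" "b < n" "c < n"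
  shows "a * b * c + h_rec a + h_rec b + h_rec c \<le> h_rec n"
proof (cases "n \<le> 2")
  case True
  have "a = 0 \<or> b = 0 \<or> c = 0" using assms True by linarith
  moreover have "h_rec a = 0" "h_rec b = 0" "h_rec c = 0"
    using assms True by (simp_all add: h_rec.simps)
  ultimately show ?thesis by auto
next
  case False
  show ?thesis
    by (subst (4) h_rec.simps)
      (use False h_rec_wf(1)[of n] assms in \<open>auto intro!: Max_ge image_eqI[of _ _ "(a, b, c)"]\<close>)
qed

lemma h_rec_obtain:
  assumes "n \<ge> 3"
  obtains a b c where "a + b + c = n" "a < n" "b < n" "c < n"
    "h_rec n = a * b * c + h_rec a + h_rec b + h_rec c"
proof -
  let ?f = "\<lambda>(a, b, c). a * b * c + h_rec a + h_rec b + h_rec c"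
  let ?S = "{(a, b, c). a + b + c = n \<and> a < n \<and> b < n \<and> c < n}"
  have "h_rec n = Max (?f ` ?S)" using assms by (subst h_rec.simps) simp
  moreover have "Max (?f ` ?S) \<in> ?f ` ?S" using h_rec_wf[OF assms] by (intro Max_in) auto
  ultimately show ?thesis using that by auto
qed

lemma h_rec_superadditive: "h_rec a + h_rec b \<le> h_rec (a + b)"
proof (cases "a = 0 \<or> b = 0")
  case True
  then show ?thesis using h_rec_small by auto
next
  case False
  then show ?thesis using h_rec_ge[of a b 0 "a + b"] by simp
qed

text \<open>After expansion this is \<open>6 a b c \<le> a (b\<^sup>2 + c\<^sup>2) + b (a\<^sup>2 + c\<^sup>2) + c (a\<^sup>2 + b\<^sup>2)\<close>, the sum of
  three cases of \<open>2 x y \<le> x\<^sup>2 + y\<^sup>2\<close>.\<close>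

lemma triple_product_bound:
  fixes a b c :: nat
  shows "24 * (a * b * c) + a ^ 3 + b ^ 3 + c ^ 3 \<le> (a + b + c) ^ 3"
proof -
  have key: "2 * (x * y) \<le> x\<^sup>2 + y\<^sup>2" for x y :: nat
    using sum_squares_bound[of "real x" "real y"] by (metis (mono_tags) mult.assoc of_nat_le_iff of_nat_add of_nat_mult of_nat_numeral of_nat_power)
  have "c * (2 * (a * b)) \<le> c * (a\<^sup>2 + b\<^sup>2)" "b * (2 * (a * c)) \<le> b * (a\<^sup>2 + c\<^sup>2)" "a * (2 * (b * c)) \<le> a * (b\<^sup>2 + c\<^sup>2)"
    using key by (intro mult_left_mono; simp)+
  then show ?thesis by (simp add: power2_eq_square power3_eq_cube algebra_simps)
qed

lemma h_rec_cubic_bound: "24 * h_rec n + n \<le> n ^ 3"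
proof (induction n rule: less_induct)
  case (less n)
  show ?case
  proof (cases "n \<le> 2")
    case True
    then have "h_rec n = 0" by (simp add: h_rec.simps)
    moreover have "n \<le> n ^ 3" by (cases "n = 0") (auto intro: self_le_power)
    ultimately show ?thesis by simp
  next
    case False
    then obtain a b c where abc: "a + b + c = n" "a < n" "b < n" "c < n"
      and h: "h_rec n = a * b * c + h_rec a + h_rec b + h_rec c"
      using h_rec_obtain[of n] by auto
    show ?thesis
      using less.IH[OF abc(2)] less.IH[OF abc(3)] less.IH[OF abc(4)] triple_product_bound[of a b c] h abc(1)
      by simp
  qed
qed

text \<open>Equal parts make every inequality behind \<open>h_rec_cubic_bound\<close> an equality, and a power of three
  can be cut into equal parts all the way down.\<close>

lemma h_rec_power3: "24 * h_rec (3 ^ k) + 3 ^ k = (3 ^ k) ^ 3"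
proof (induction k)
  case 0
  then show ?case using h_rec_small by simp
next
  case (Suc k)
  have "3 ^ k * 3 ^ k * 3 ^ k + h_rec (3 ^ k) + h_rec (3 ^ k) + h_rec (3 ^ k) \<le> h_rec (3 ^ Suc k)"
    by (intro h_rec_ge) auto
  then show ?case
    using Suc.IH h_rec_cubic_bound[of "3 ^ Suc k"] by (simp add: power3_eq_cube)
qed

section \<open>Weighted triple systems\<close>

definition covers_pairs :: "('a set \<Rightarrow> bool) \<Rightarrow> 'a set \<Rightarrow> bool" where
  "covers_pairs E Q \<longleftrightarrow> (\<forall>x\<in>Q. \<forall>y\<in>Q. x \<noteq> y \<longrightarrow> (\<exists>S\<subseteq>Q. E S \<and> x \<in> S \<and> y \<in> S))"

definition splits :: "('a set \<Rightarrow> bool) \<Rightarrow> 'a set \<Rightarrow> 'a set \<Rightarrow> 'a set \<Rightarrow> bool" where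
  "splits E A B C \<longleftrightarrow> A \<inter> B = {} \<and> A \<inter> C = {} \<and> B \<inter> C = {} \<and>
    (\<forall>S\<subseteq>A \<union> B \<union> C. E S \<longrightarrow>
      S \<subseteq> A \<or> S \<subseteq> B \<or> S \<subseteq> C \<or> (\<exists>a\<in>A. \<exists>b\<in>B. \<exists>c\<in>C. S = {a, b, c}))"

definition edge_weight :: "('a set \<Rightarrow> bool) \<Rightarrow> 'a set \<Rightarrow> ('a \<Rightarrow> nat) \<Rightarrow> nat" where
  "edge_weight E Q m = (\<Sum>S | S \<subseteq> Q \<and> E S. \<Prod>x\<in>S. m x)"

text \<open>The weight is affine in the weight of a single point; the slope is the weighted degree of the point.\<close>

lemma edge_weight_remove:
  assumes fin: "finite Q" and "x \<in> Q"
  shows "edge_weight E Q m =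
    edge_weight E (Q - {x}) m + m x * (\<Sum>S | S \<subseteq> Q \<and> E S \<and> x \<in> S. \<Prod>z\<in>S - {x}. m z)"
proof -
  have split: "{S. S \<subseteq> Q \<and> E S} = {S. S \<subseteq> Q - {x} \<and> E S} \<union> {S. S \<subseteq> Q \<and> E S \<and> x \<in> S}" by auto
  have "edge_weight E Q m = edge_weight E (Q - {x}) m + (\<Sum>S | S \<subseteq> Q \<and> E S \<and> x \<in> S. \<Prod>z\<in>S. m z)"
    unfolding edge_weight_def split using fin by (intro sum.union_disjoint) auto
  also have "(\<Sum>S | S \<subseteq> Q \<and> E S \<and> x \<in> S. \<Prod>z\<in>S. m z) = (\<Sum>S | S \<subseteq> Q \<and> E S \<and> x \<in> S. m x * (\<Prod>z\<in>S - {x}. m z))"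
    using fin by (intro sum.cong refl prod.remove) (auto intro: finite_subset)
  finally show ?thesis by (simp add: sum_distrib_left)
qed

lemma edge_weight_cong: "(\<And>x. x \<in> Q \<Longrightarrow> m x = m' x) \<Longrightarrow> edge_weight E Q m = edge_weight E Q m'"
  unfolding edge_weight_def by (intro sum.cong refl prod.cong) auto

text \<open>No edge contains both points, so the slopes at \<open>x\<close> and at \<open>y\<close> involve neither \<open>m x\<close> nor \<open>m y\<close>.
  Moving all of the weight to the point with the larger slope therefore does not decrease the total.\<close>

lemma edge_weight_merge:
  assumes fin: "finite Q" and xy: "x \<in> Q" "y \<in> Q" "x \<noteq> y"
    and unc: "\<And>S. S \<subseteq> Q \<Longrightarrow> E S \<Longrightarrow> x \<in> S \<Longrightarrow> y \<notin> S"
  shows "edge_weight E Q m \<le> edge_weight E (Q - {y}) (m(x := m x + m y)) \<or>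
         edge_weight E Q m \<le> edge_weight E (Q - {x}) (m(y := m x + m y))"
proof -
  define d where "d z = (\<Sum>S | S \<subseteq> Q \<and> E S \<and> z \<in> S. \<Prod>w\<in>S - {z}. m w)" for z
  let ?R = "edge_weight E (Q - {x} - {y}) m"
  \<comment> \<open>Removing one of the two points does not change the edges at the other.\<close>
  have dx: "{S. S \<subseteq> Q - {y} \<and> E S \<and> x \<in> S} = {S. S \<subseteq> Q \<and> E S \<and> x \<in> S}" using unc by blast
  have dy: "{S. S \<subseteq> Q - {x} \<and> E S \<and> y \<in> S} = {S. S \<subseteq> Q \<and> E S \<and> y \<in> S}" using unc by blast
  have Q: "edge_weight E Q m = ?R + m x * d x + m y * d y"
    using edge_weight_remove[OF fin xy(1), of E m] edge_weight_remove[of "Q - {x}" y E m] fin xy dy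
    by (simp add: d_def)
  have upd: "(\<Prod>w\<in>S - {z}. (m(z := k)) w) = (\<Prod>w\<in>S - {z}. m w)" for S z k
    by (intro prod.cong) auto
  have comm: "Q - {y} - {x} = Q - {x} - {y}" by blast
  have X: "edge_weight E (Q - {y}) (m(x := m x + m y)) = ?R + (m x + m y) * d x"
  proof -
    have "edge_weight E (Q - {x} - {y}) (m(x := m x + m y)) = ?R"
      by (rule edge_weight_cong) auto
    then show ?thesis
      using edge_weight_remove[of "Q - {y}" x E "m(x := m x + m y)"] fin xy
      unfolding comm dx upd d_def by simp
  qed
  have Y: "edge_weight E (Q - {x}) (m(y := m x + m y)) = ?R + (m x + m y) * d y"
  proof -
    have "edge_weight E (Q - {x} - {y}) (m(y := m x + m y)) = ?R"
      by (rule edge_weight_cong) auto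
    then show ?thesis
      using edge_weight_remove[of "Q - {x}" y E "m(y := m x + m y)"] fin xy
      unfolding dy upd d_def by simp
  qed
  have "m y * d y \<le> m y * d x \<or> m x * d x \<le> m x * d y"
    using linear[of "d x" "d y"] by (auto intro: mult_left_mono)
  then show ?thesis unfolding Q X Y by (auto simp: algebra_simps)
qed

lemma edge_weight_split:
  assumes fin: "finite A" "finite B" "finite C" and split: "splits E A B C"
  shows "edge_weight E (A \<union> B \<union> C) m \<le>
    sum m A * sum m B * sum m C + edge_weight E A m + edge_weight E B m + edge_weight E C m"
proof -
  have disj: "A \<inter> B = {}" "A \<inter> C = {}" "B \<inter> C = {}"
    and edges: "\<And>S. S \<subseteq> A \<union> B \<union> C \<Longrightarrow> E S \<Longrightarrow>
      S \<subseteq> A \<or> S \<subseteq> B \<or> S \<subseteq> C \<or> (\<exists>a\<in>A. \<exists>b\<in>B. \<exists>c\<in>C. S = {a, b, c})"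
    using split unfolding splits_def by simp_all
  let ?t = "\<lambda>(a, b, c). {a, b, c}" and ?w = "\<lambda>S. \<Prod>x\<in>S. m x"
  let ?in = "\<lambda>A. {S. S \<subseteq> A \<and> E S}"
  have f: "finite (?in A)" "finite (?in B)" "finite (?in C)" using fin by auto
  have "edge_weight E (A \<union> B \<union> C) m \<le> sum ?w (?t ` (A \<times> B \<times> C) \<union> ?in A \<union> ?in B \<union> ?in C)"
    unfolding edge_weight_def
  proof (intro sum_mono2)
    show "{S. S \<subseteq> A \<union> B \<union> C \<and> E S} \<subseteq> ?t ` (A \<times> B \<times> C) \<union> ?in A \<union> ?in B \<union> ?in C"
    proof
      fix S assume "S \<in> {S. S \<subseteq> A \<union> B \<union> C \<and> E S}"
      then have S: "S \<subseteq> A \<union> B \<union> C" "E S" by auto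
      have "S \<in> ?t ` (A \<times> B \<times> C)" if "a \<in> A" "b \<in> B" "c \<in> C" "S = {a, b, c}" for a b c
        using that by (intro image_eqI[of _ _ "(a, b, c)"]) auto
      then show "S \<in> ?t ` (A \<times> B \<times> C) \<union> ?in A \<union> ?in B \<union> ?in C"
        using edges[OF S] S(2) by blast
    qed
  qed (use fin in auto)
  also have "\<dots> \<le> sum ?w (?t ` (A \<times> B \<times> C)) + sum ?w (?in A) + sum ?w (?in B) + sum ?w (?in C)"
  proof -
    have un: "sum ?w (X \<union> Y) \<le> sum ?w X + sum ?w Y" if "finite X" "finite Y" for X Y
      using sum.union_inter[OF that, of ?w] by simp
    have ft: "finite (?t ` (A \<times> B \<times> C))" using fin by simp
    show ?thesis
      using un[of "?t ` (A \<times> B \<times> C) \<union> ?in A \<union> ?in B" "?in C"]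
        un[of "?t ` (A \<times> B \<times> C) \<union> ?in A" "?in B"] un[OF ft f(1)] ft f
      by simp
  qed
  also have "sum ?w (?t ` (A \<times> B \<times> C)) \<le> sum (?w \<circ> ?t) (A \<times> B \<times> C)"
    using fin by (intro sum_image_le) auto
  also have "sum (?w \<circ> ?t) (A \<times> B \<times> C) = (\<Sum>(a, b, c)\<in>A \<times> B \<times> C. m a * (m b * m c))"
  proof (intro sum.cong refl, clarsimp)
    fix a b c assume "a \<in> A" "b \<in> B" "c \<in> C"
    then have "a \<noteq> b" "a \<noteq> c" "b \<noteq> c" using disj by auto
    then show "prod m {a, b, c} = m a * (m b * m c)" by simp
  qed
  also have "\<dots> = sum m A * (sum m B * sum m C)"
    by (simp add: sum.cartesian_product' flip: sum_distrib_left sum_distrib_right)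
  finally show ?thesis by (simp add: edge_weight_def algebra_simps)
qed

text \<open>Induction on the number of points. If some pair is in no edge, merging it lowers this number while
  the total weight stays. Otherwise the split reduces the claim to the three parts; positive weights
  make their weights smaller than the total, as the recursion for \<open>h_rec\<close> demands.\<close>

lemma recursive_bound:
  fixes E :: "'a set \<Rightarrow> bool"
  assumes card3: "\<And>S. E S \<Longrightarrow> card S = 3"
    and split: "\<And>Q. finite Q \<Longrightarrow> card Q \<ge> 2 \<Longrightarrow> covers_pairs E Q \<Longrightarrow>
        \<exists>A B C. Q = A \<union> B \<union> C \<and> A \<noteq> {} \<and> B \<noteq> {} \<and> C \<noteq> {} \<and> splits E A B C"
    and fin: "finite Q" and pos: "\<And>x. x \<in> Q \<Longrightarrow> m x > 0"
  shows "edge_weight E Q m + (\<Sum>x\<in>Q. h_rec (m x)) \<le> h_rec (sum m Q)"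
  using fin pos
proof (induction "card Q" arbitrary: Q m rule: less_induct)
  case less
  note IH = less.hyps and fin = \<open>finite Q\<close> and pos = less.prems(2)
  consider "card Q = 0" | "card Q = 1"
    | (uncovered) x y where "x \<in> Q" "y \<in> Q" "x \<noteq> y" "\<And>S. S \<subseteq> Q \<Longrightarrow> E S \<Longrightarrow> x \<in> S \<Longrightarrow> y \<notin> S"
    | (covered) "card Q \<ge> 2" "covers_pairs E Q"
    unfolding covers_pairs_def by (metis One_nat_def Suc_1 less_2_cases not_less)
  then show ?case
  proof cases
    case 1
    then have "Q = {}" using fin by simp
    moreover have "edge_weight E {} m = 0"
      unfolding edge_weight_def using card3[of "{}"] by (intro sum.neutral) auto
    ultimately show ?thesis by simp
  next
    case 2
    then obtain x where Q: "Q = {x}" by (meson card_1_singletonE)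
    have "\<not> E S" if "S \<subseteq> Q" for S
      using card_mono[OF fin that] card3[of S] 2 by auto
    then have "edge_weight E Q m = 0" unfolding edge_weight_def by (intro sum.neutral) auto
    then show ?thesis by (simp add: Q)
  next
    case uncovered
    have move: "edge_weight E (Q - {v}) (m(u := m u + m v)) + (\<Sum>x\<in>Q. h_rec (m x)) \<le> h_rec (sum m Q)"
      if uv: "u \<in> Q" "v \<in> Q" "u \<noteq> v" for u v
    proof -
      let ?m = "m(u := m u + m v)" and ?R = "Q - {v} - {u}"
      have sums: "(\<Sum>x\<in>Q. g (m x)) = g (m u) + g (m v) + (\<Sum>x\<in>?R. g (m x))"
        "(\<Sum>x\<in>Q - {v}. g (?m x)) = g (m u + m v) + (\<Sum>x\<in>?R. g (m x))" for g :: "nat \<Rightarrow> nat"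
      proof -
        have "(\<Sum>x\<in>Q. g (m x)) = g (m v) + (g (m u) + (\<Sum>x\<in>?R. g (m x)))"
          using uv fin by (simp add: sum.remove[of Q v] sum.remove[of "Q - {v}" u])
        then show "(\<Sum>x\<in>Q. g (m x)) = g (m u) + g (m v) + (\<Sum>x\<in>?R. g (m x))" by simp
        have "(\<Sum>x\<in>Q - {v}. g (?m x)) = g (?m u) + (\<Sum>x\<in>?R. g (?m x))"
          using uv fin by (intro sum.remove) auto
        also have "(\<Sum>x\<in>?R. g (?m x)) = (\<Sum>x\<in>?R. g (m x))" by (intro sum.cong) auto
        finally show "(\<Sum>x\<in>Q - {v}. g (?m x)) = g (m u + m v) + (\<Sum>x\<in>?R. g (m x))" by simp
      qed
      have "card (Q - {v}) < card Q" using uv fin by (intro psubset_card_mono) auto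
      then have "edge_weight E (Q - {v}) ?m + (\<Sum>x\<in>Q - {v}. h_rec (?m x)) \<le> h_rec (sum ?m (Q - {v}))"
        by (rule IH) (use fin pos uv in auto)
      moreover have "sum ?m (Q - {v}) = sum m Q" using sums[of "\<lambda>x. x"] by simp
      ultimately have "edge_weight E (Q - {v}) ?m + (\<Sum>x\<in>Q - {v}. h_rec (?m x)) \<le> h_rec (sum m Q)" by metis
      then show ?thesis using sums[of h_rec] h_rec_superadditive[of "m u" "m v"] by linarith
    qed
    have "edge_weight E Q m \<le> edge_weight E (Q - {y}) (m(x := m x + m y)) \<or>
         edge_weight E Q m \<le> edge_weight E (Q - {x}) (m(y := m x + m y))"
      using uncovered by (intro edge_weight_merge fin) auto
    then show ?thesis
      using move[of x y] move[of y x] uncovered(1-3) by (auto simp: add.commute)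
  next
    case covered
    obtain A B C where ABC: "Q = A \<union> B \<union> C" and ne: "A \<noteq> {}" "B \<noteq> {}" "C \<noteq> {}"
      and splits: "splits E A B C"
      using split[OF fin covered] by blast
    have disj: "A \<inter> B = {}" "A \<inter> C = {}" "B \<inter> C = {}" using splits by (auto simp: splits_def)
    have fins: "finite A" "finite B" "finite C" using fin ABC by auto
    have parts: "edge_weight E R m + (\<Sum>x\<in>R. h_rec (m x)) \<le> h_rec (sum m R)" if "R \<in> {A, B, C}" for R
    proof (rule IH)
      have "R \<subset> Q" using that ABC disj ne by auto
      then show "card R < card Q" using fin by (rule psubset_card_mono[rotated])
    qed (use that fins pos ABC in auto)
    have sums: "sum g Q = sum g A + sum g B + sum g C" for g :: "'a \<Rightarrow> nat"
      unfolding ABC using fins disj by (subst sum.union_disjoint; auto simp: sum.union_disjoint)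
    have "sum m R > 0" if "R \<in> {A, B, C}" for R
      using that fins ne pos unfolding ABC by (intro sum_pos) blast+
    then have "sum m A * sum m B * sum m C + h_rec (sum m A) + h_rec (sum m B) + h_rec (sum m C) \<le> h_rec (sum m Q)"
      using sums[of m] by (intro h_rec_ge) auto
    moreover have "edge_weight E Q m \<le>
      sum m A * sum m B * sum m C + edge_weight E A m + edge_weight E B m + edge_weight E C m"
      unfolding ABC by (intro edge_weight_split fins splits)
    ultimately show ?thesis
      using parts[of A] parts[of B] parts[of C] sums[of "\<lambda>x. h_rec (m x)"] by simp
  qed
qed

section \<open>Almost equilateral triangles in the complex plane\<close>

definition rot60 :: complex where "rot60 = Complex (1/2) (sqrt 3 / 2)"

text \<open>Every triangle with angles between 59 and 61 degrees has its third vertex within 0.0275 times the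
  base of the apex of an equilateral triangle. The value is rounded up to one that still keeps the
  clusters apart: with the radii 0.294 and 0.34 found below, \<open>2 * (1 + slack) * 0.34 + 0.294 < 1\<close>.\<close>

definition slack :: real where "slack = 7 / 250"

definition near_equilateral :: "complex \<Rightarrow> complex \<Rightarrow> complex \<Rightarrow> bool" where
  "near_equilateral x y z \<longleftrightarrow>
     (\<exists>\<sigma>\<in>{rot60, cnj rot60}. cmod (z - x - \<sigma> * (y - x)) \<le> slack * cmod (y - x))"

lemma rot60_sq: "rot60 * rot60 = rot60 - 1"
  by (simp add: rot60_def complex_eq_iff)

lemma cnj_rot60: "cnj rot60 = 1 - rot60"
  by (simp add: rot60_def complex_eq_iff)

lemma cmod_rot60 [simp]: "cmod rot60 = 1"
  by (simp add: rot60_def cmod_def power_divide)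

lemma cmod_cnj_rot60 [simp]: "cmod (1 - rot60) = 1"
  by (metis cmod_rot60 cnj_rot60 complex_mod_cnj)

lemma cmod_rotated [simp]: "\<sigma> \<in> {rot60, cnj rot60} \<Longrightarrow> cmod \<sigma> = 1" "\<sigma> \<in> {rot60, cnj rot60} \<Longrightarrow> cmod (1 - \<sigma>) = 1"
  by (auto simp: cnj_rot60)

text \<open>The cosine is 1-Lipschitz, and one degree is less than 0.0175.\<close>

lemma cos_near_60:
  assumes "\<bar>\<alpha> - pi/3\<bar> < pi/180"
  shows "cos \<alpha> \<ge> (4825 / 10000)"
proof -
  have pi: "pi / 180 < (17454 / 1000000)" "pi > 0" using pi_approx by auto
  have "\<bar>cos \<alpha> - cos (pi/3)\<bar> = 2 * \<bar>sin ((\<alpha> + pi/3)/2)\<bar> * \<bar>sin ((pi/3 - \<alpha>)/2)\<bar>"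
    by (simp add: cos_diff_cos abs_mult)
  also have "\<dots> \<le> 2 * 1 * \<bar>(pi/3 - \<alpha>)/2\<bar>"
    by (intro mult_mono abs_sin_x_le_abs_x) auto
  finally have "\<bar>cos \<alpha> - 1/2\<bar> \<le> \<bar>\<alpha> - pi/3\<bar>" by (simp add: cos_60 abs_minus_commute)
  then show "cos \<alpha> \<ge> (4825 / 10000)" using assms pi by linarith
qed

text \<open>The constant improves on the trivial \<open>2 * pi / 180\<close> by a bound for the sine of the mean of
  the two angles, which is close to \<open>sqrt 3 / 2\<close>. Without this factor the tolerance would be too large to
  separate the clusters.\<close>

lemma cos_near_60_diff:
  assumes "\<bar>\<beta> - pi/3\<bar> < pi/180" "\<bar>\<gamma> - pi/3\<bar> < pi/180"
  shows "\<bar>cos \<gamma> - cos \<beta>\<bar> \<le> 306 / 10000"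
proof -
  define \<mu> where "\<mu> = (\<gamma> + \<beta>) / 2"
  have pi: "pi / 180 < (17454 / 1000000)" "pi > 0" using pi_approx by auto
  have \<mu>: "\<bar>\<mu> - pi/3\<bar> < pi/180" using assms by (simp add: \<mu>_def abs_if split: if_splits)
  have "cos \<mu> \<ge> (4825 / 10000)" using cos_near_60[OF \<mu>] .
  then have "(cos \<mu>)\<^sup>2 \<ge> (4825 / 10000)\<^sup>2" by (intro power_mono) auto
  then have "(sin \<mu>)\<^sup>2 \<le> (8765 / 10000)\<^sup>2" using sin_cos_squared_add[of \<mu>] by (simp add: power2_eq_square)
  then have s: "\<bar>sin \<mu>\<bar> \<le> (8765 / 10000)" by (subst (asm) power2_le_iff_abs_le) auto
  have "\<bar>cos \<gamma> - cos \<beta>\<bar> = 2 * \<bar>sin \<mu>\<bar> * \<bar>sin ((\<beta> - \<gamma>)/2)\<bar>"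
    by (simp add: cos_diff_cos abs_mult \<mu>_def)
  also have "\<dots> \<le> 2 * (8765 / 10000) * \<bar>(\<beta> - \<gamma>)/2\<bar>"
    using s by (intro mult_mono abs_sin_x_le_abs_x) auto
  also have "\<dots> \<le> 2 * (8765 / 10000) * (17454 / 1000000)"
  proof (intro mult_left_mono)
    show "\<bar>(\<beta> - \<gamma>)/2\<bar> \<le> 17454 / 1000000"
    proof -
      have "\<beta> - \<gamma> \<le> 2 * (17454 / 1000000)" "\<gamma> - \<beta> \<le> 2 * (17454 / 1000000)"
        using assms pi unfolding abs_less_iff by linarith+
      then show ?thesis by (simp add: abs_if field_simps)
    qed
  qed simp
  finally show ?thesis by simp
qed

lemma one_minus_cos_le: "1 - cos t \<le> t\<^sup>2 / 2" for t :: real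
proof -
  have "1 - cos t = 2 * (sin (t/2))\<^sup>2" using cos_double_sin[of "t/2"] by simp
  also have "\<dots> \<le> 2 * (t/2)\<^sup>2" using abs_sin_x_le_abs_x[of "t/2"] unfolding abs_le_square_iff by simp
  finally show ?thesis by (simp add: power_divide)
qed

text \<open>The first two hypotheses are the projection formulas for the sides \<open>b\<close> and \<open>c\<close> of a triangle.
  Subtracted, they give \<open>(b - c) * (1 + cos \<alpha>) = a * (cos \<gamma> - cos \<beta>)\<close>.\<close>

lemma side_difference:
  assumes b: "b = c * cos \<alpha> + a * cos \<gamma>" and c: "c = b * cos \<alpha> + a * cos \<beta>"
    and a: "a > 0"
    and ang: "\<bar>\<alpha> - pi/3\<bar> < pi/180" "\<bar>\<beta> - pi/3\<bar> < pi/180" "\<bar>\<gamma> - pi/3\<bar> < pi/180"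
  shows "\<bar>b - c\<bar> \<le> (2065 / 100000) * a"
proof -
  have "(b - c) * (1 + cos \<alpha>) = a * (cos \<gamma> - cos \<beta>)" using b c by algebra
  then have "\<bar>b - c\<bar> * (1 + cos \<alpha>) = a * \<bar>cos \<gamma> - cos \<beta>\<bar>"
    using a cos_near_60[OF ang(1)] by (metis abs_mult abs_of_pos add_pos_pos less_le_trans divide_pos_pos zero_less_numeral zero_less_one)
  also have "\<dots> \<le> a * (306 / 10000)" using cos_near_60_diff[OF ang(2,3)] a by (intro mult_left_mono) auto
  finally have 1: "\<bar>b - c\<bar> * (1 + cos \<alpha>) \<le> a * (306 / 10000)" .
  have "\<bar>b - c\<bar> * (14825 / 10000) \<le> \<bar>b - c\<bar> * (1 + cos \<alpha>)"
    using cos_near_60[OF ang(1)] by (intro mult_left_mono) auto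
  then show ?thesis using 1 a by simp
qed

text \<open>With \<open>u\<close> and \<open>v\<close> the sides at \<open>x\<close>, of lengths \<open>c\<close> and \<open>b\<close>, and \<open>\<sigma>\<close> the rotation by 60 degrees towards
  \<open>v\<close>, the law of cosines reads \<open>\<bar>v - \<sigma> u\<bar>\<^sup>2 = (b - c)\<^sup>2 + 2 b c (1 - cos (\<alpha> - pi/3))\<close>. The first term is
  controlled by \<open>side_difference\<close>, the second by \<open>\<alpha>\<close> being within a degree of \<open>pi/3\<close>.\<close>

lemma near_equilateral_if_angles:
  fixes x y z :: complex
  assumes ne: "x \<noteq> y" "y \<noteq> z" "x \<noteq> z"
    and x: "(y - x) \<bullet> (z - x) = cmod (y - x) * cmod (z - x) * cos \<alpha>"
    and y: "(x - y) \<bullet> (z - y) = cmod (x - y) * cmod (z - y) * cos \<beta>"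
    and z: "(x - z) \<bullet> (y - z) = cmod (x - z) * cmod (y - z) * cos \<gamma>"
    and ang: "\<bar>\<alpha> - pi/3\<bar> < pi/180" "\<bar>\<beta> - pi/3\<bar> < pi/180" "\<bar>\<gamma> - pi/3\<bar> < pi/180"
  shows "near_equilateral x y z"
proof -
  define u v where "u = y - x" and "v = z - x"
  define a b c where "a = cmod (v - u)" and "b = cmod v" and "c = cmod u"
  have pos: "a > 0" "b > 0" "c > 0" using ne by (auto simp: a_def b_def c_def u_def v_def)
  have ix: "u \<bullet> v = c * b * cos \<alpha>" using x by (simp add: u_def v_def b_def c_def)
  have iy: "u \<bullet> (u - v) = c * a * cos \<beta>"
    using y by (simp add: u_def v_def a_def c_def norm_minus_commute inner_diff)
  have iz: "v \<bullet> (v - u) = b * a * cos \<gamma>"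
    using z by (simp add: u_def v_def a_def b_def norm_minus_commute inner_diff)
  have "c * c = c * (b * cos \<alpha> + a * cos \<beta>)"
  proof -
    have "c * c = u \<bullet> u" by (simp add: c_def dot_square_norm power2_eq_square)
    also have "\<dots> = u \<bullet> v + u \<bullet> (u - v)" by (simp add: inner_diff)
    finally show ?thesis using ix iy by (simp add: algebra_simps)
  qed
  then have c: "c = b * cos \<alpha> + a * cos \<beta>" using pos by simp
  have "b * b = b * (c * cos \<alpha> + a * cos \<gamma>)"
  proof -
    have "b * b = v \<bullet> v" by (simp add: b_def dot_square_norm power2_eq_square)
    also have "\<dots> = u \<bullet> v + v \<bullet> (v - u)" by (simp add: inner_diff inner_commute)
    finally show ?thesis using ix iz by (simp add: algebra_simps)
  qed
  then have b: "b = c * cos \<alpha> + a * cos \<gamma>" using pos by simp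
  have "a * a = a * (c * cos \<beta> + b * cos \<gamma>)"
  proof -
    have "a * a = (v - u) \<bullet> (v - u)" by (simp add: a_def dot_square_norm power2_eq_square)
    also have "\<dots> = u \<bullet> (u - v) + v \<bullet> (v - u)" by (simp add: inner_diff inner_commute)
    finally show ?thesis using iy iz by (simp add: algebra_simps)
  qed
  then have a: "a = c * cos \<beta> + b * cos \<gamma>" using pos by simp
  have bc: "\<bar>b - c\<bar> \<le> (2065 / 100000) * a"
    using side_difference[OF b c pos(1) ang] .
  have ba: "\<bar>b - a\<bar> \<le> (2065 / 100000) * c"
    using b a pos(3) ang by (intro side_difference[of b a \<gamma> c \<alpha> \<beta>]) linarith+
  have ca: "\<bar>c - a\<bar> \<le> (2065 / 100000) * b"
    using c a pos(2) ang by (intro side_difference[of c a \<beta> b \<alpha> \<gamma>]) linarith+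
  have a_le: "a \<le> (10211 / 10000) * c" and b_le: "b \<le> (10211 / 10000) * c"
    using bc ba ca pos by (simp_all add: abs_if split: if_splits)
  \<comment> \<open>The sign of \<open>Im q\<close> is the orientation of the triangle, which decides the sense of the rotation.\<close>
  define q where "q = v * cnj u"
  have Req: "Re q = c * b * cos \<alpha>" using ix by (simp add: q_def inner_complex_def algebra_simps)
  have "(Re q)\<^sup>2 + (Im q)\<^sup>2 = (c * b)\<^sup>2"
    by (metis Complex.cmod_power2 b_def c_def complex_mod_cnj mult.commute norm_mult q_def)
  then have "(Im q)\<^sup>2 = (c * b * sin \<alpha>)\<^sup>2"
    unfolding Req using sin_cos_squared_add[of \<alpha>] by algebra
  moreover have "sin \<alpha> > 0" using ang(1) pi_gt_zero by (intro sin_gt_zero) (auto simp: abs_if split: if_splits)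
  ultimately have Imq: "\<bar>Im q\<bar> = c * b * sin \<alpha>"
    using pos by (simp add: power2_eq_iff abs_if) (smt (verit) mult_pos_pos)
  define \<sigma> where "\<sigma> = (if Im q \<ge> 0 then rot60 else cnj rot60)"
  have \<sigma>: "\<sigma> \<in> {rot60, cnj rot60}" by (simp add: \<sigma>_def)
  have "v \<bullet> (\<sigma> * u) = Re (q * cnj \<sigma>)" by (simp add: q_def inner_complex_def algebra_simps)
  also have "\<dots> = c * b * cos (\<alpha> - pi/3)"
  proof (cases "Im q \<ge> 0")
    case True
    then have "Im q = c * b * sin \<alpha>" using Imq by simp
    then show ?thesis
      using True by (simp add: Req \<sigma>_def rot60_def cos_diff cos_60 sin_60 algebra_simps)
  next
    case False
    then have "Im q = - (c * b * sin \<alpha>)" using Imq by simp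
    then show ?thesis
      using False by (simp only: Req \<sigma>_def) (simp add: Req rot60_def cos_diff cos_60 sin_60 algebra_simps)
  qed
  finally have inn: "v \<bullet> (\<sigma> * u) = c * b * cos (\<alpha> - pi/3)" .
  have "(cmod (v - \<sigma> * u))\<^sup>2 = b\<^sup>2 + c\<^sup>2 - 2 * (c * b * cos (\<alpha> - pi/3))"
  proof -
    have "(cmod (v - \<sigma> * u))\<^sup>2 = (cmod v)\<^sup>2 + (cmod (\<sigma> * u))\<^sup>2 - 2 * (v \<bullet> (\<sigma> * u))"
      by (simp only: power2_norm_eq_inner inner_diff inner_commute[of "\<sigma> * u" v])
    then show ?thesis using \<sigma> by (simp only: inn norm_mult cmod_rotated b_def c_def mult_1)
  qed
  also have "\<dots> = (b - c)\<^sup>2 + 2 * (c * b) * (1 - cos (\<alpha> - pi/3))" by algebra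
  also have "\<dots> \<le> ((2065 / 100000) * (10211 / 10000) * c)\<^sup>2 + 2 * (c * ((10211 / 10000) * c)) * ((17454 / 1000000)\<^sup>2 / 2)"
  proof (intro add_mono mult_mono)
    show "(b - c)\<^sup>2 \<le> ((2065 / 100000) * (10211 / 10000) * c)\<^sup>2"
      using bc a_le pos by (intro power2_le_iff_abs_le[THEN iffD2]) auto
    have "(\<alpha> - pi/3)\<^sup>2 \<le> (17454 / 1000000)\<^sup>2"
      using ang(1) pi_approx by (intro power2_le_iff_abs_le[THEN iffD2]) auto
    then show "1 - cos (\<alpha> - pi/3) \<le> (17454 / 1000000)\<^sup>2 / 2" using one_minus_cos_le[of "\<alpha> - pi/3"] by simp
  qed (use pos b_le in auto)
  also have "\<dots> \<le> (slack * c)\<^sup>2" by (simp add: slack_def power2_eq_square)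
  finally have "cmod (v - \<sigma> * u) \<le> slack * c"
    by (rule power2_le_imp_le) (use pos in \<open>simp add: slack_def\<close>)
  then show ?thesis using \<sigma> unfolding near_equilateral_def u_def v_def c_def by blast
qed

text \<open>Exchanging the endpoints of the base exchanges the two senses of rotation.\<close>

lemma near_equilateral_swap:
  assumes "cmod (z - x - cnj rot60 * (y - x)) \<le> r"
  shows "cmod (z - y - rot60 * (x - y)) \<le> r"
  using assms by (simp add: cnj_rot60 algebra_simps)

section \<open>Sets in which almost equilateral triangles cover all pairs\<close>

text \<open>Two discs of radius about \<open>D\<close> whose centres are \<open>2 * D\<close> apart meet only near the midpoint \<open>c\<close>.\<close>

lemma parallelogram_bound:
  fixes p c w :: complex
  assumes "cmod (p - (c + w)) \<le> s" "cmod (p - (c - w)) \<le> t" "cmod w = D"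
  shows "2 * (cmod (p - c))\<^sup>2 + 2 * D\<^sup>2 \<le> s\<^sup>2 + t\<^sup>2"
proof -
  have "2 * (cmod (p - c))\<^sup>2 + 2 * (cmod w)\<^sup>2 = (cmod (p - (c + w)))\<^sup>2 + (cmod (p - (c - w)))\<^sup>2"
    unfolding cmod_power2 by (simp add: power2_eq_square algebra_simps)
  also have "\<dots> \<le> s\<^sup>2 + t\<^sup>2" using assms by (intro add_mono power_mono) auto
  finally show ?thesis using assms by simp
qed

text \<open>If \<open>w\<close> is almost the image of \<open>p\<close> under the rotation by \<open>\<sigma>\<close> about \<open>x\<close>, then a disc containing \<open>w\<close>
  can be rotated back, by \<open>\<tau> = 1 / \<sigma>\<close>, to a slightly larger disc containing \<open>p\<close>.\<close>

lemma turn_back: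
  fixes p q w x :: complex
  assumes "cmod (w - x - \<sigma> * (p - x)) \<le> s" "cmod (w - q) \<le> t" "\<sigma> * \<tau> = 1" "cmod \<tau> = 1"
  shows "cmod (p - (x + \<tau> * (q - x))) \<le> t + s"
proof -
  have "p - (x + \<tau> * (q - x)) = \<tau> * ((w - q) - (w - x - \<sigma> * (p - x)))"
    using assms(3) by algebra
  then have "cmod (p - (x + \<tau> * (q - x))) = cmod ((w - q) - (w - x - \<sigma> * (p - x)))"
    using assms(4) by (simp add: norm_mult)
  also have "\<dots> \<le> cmod (w - q) + cmod (w - x - \<sigma> * (p - x))" by (rule norm_triangle_ineq4)
  finally show ?thesis using assms by simp
qed

text \<open>The points \<open>x'\<close>, \<open>y'\<close>, \<open>z'\<close> of the proof are the mirror images of the vertices of the equilateral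
  triangle \<open>x y z0\<close> in the opposite sides; \<open>x\<close>, \<open>y\<close> and \<open>z0\<close> are the midpoints of the triangle
  \<open>x' y' z'\<close>. Covering the pair of \<open>p\<close> and a vertex, and turning the third point back about that vertex, puts \<open>p\<close>
  in the disc about one of the other two mirror images. Three such choices always name two different mirror
  images, and \<open>p\<close> is near their midpoint. The radius at \<open>z'\<close> is the smaller one, because it involves only the exact
  distance of \<open>x\<close> and \<open>y\<close> and not the approximation \<open>z0\<close> of \<open>z\<close>; hence the clusters at \<open>x\<close> and \<open>y\<close> come out
  smaller than the one at \<open>z0\<close>.\<close>

lemma covered_point_near_vertex:
  fixes x y z p :: complex
  defines "v \<equiv> y - x" and "z0 \<equiv> x + rot60 * (y - x)"
  assumes D: "cmod v = D" and z: "cmod (z - z0) \<le> slack * D"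
    and p: "cmod (p - x) \<le> D" "cmod (p - y) \<le> D" "cmod (p - z) \<le> D"
    and cov: "\<And>q. q \<in> {x, y, z} \<Longrightarrow> p \<noteq> q \<Longrightarrow>
      \<exists>w. near_equilateral q p w \<and> cmod (w - x) \<le> D \<and> cmod (w - y) \<le> D \<and> cmod (w - z) \<le> D"
  shows "cmod (p - x) \<le> 294 / 1000 * D \<or> cmod (p - y) \<le> 294 / 1000 * D \<or> cmod (p - z0) \<le> 34 / 100 * D"
proof (cases "p \<in> {x, y, z}")
  case True
  moreover have "D \<ge> 0" using D by auto
  ultimately show ?thesis using z by (auto simp: slack_def)
next
  case False
  have D0: "D \<ge> 0" using D by auto
  define x' y' z' where "x' = x + (1 + rot60) * v" and "y' = x + (rot60 - 1) * v" and "z' = x + (1 - rot60) * v"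
  let ?s = "(1 + slack) * D" and ?t = "(1 + 2 * slack) * D"
  have to_z0: "cmod (w - z0) \<le> ?s" if "cmod (w - z) \<le> D" for w
    using norm_triangle_ineq[of "w - z" "z - z0"] that z by (simp add: algebra_simps)
  have inv: "rot60 * cnj rot60 = 1" "cnj rot60 * rot60 = 1"
    using rot60_sq by (simp_all add: cnj_rot60 algebra_simps)
  have e: "slack > 0" by (simp add: slack_def)
  have fx: "cmod (p - z') \<le> ?s \<or> cmod (p - y') \<le> ?t"
  proof -
    obtain w \<sigma> where w: "cmod (w - y) \<le> D" "cmod (w - z) \<le> D" and \<sigma>: "\<sigma> \<in> {rot60, cnj rot60}"
      and "cmod (w - x - \<sigma> * (p - x)) \<le> slack * cmod (p - x)"
      using cov[of x] False unfolding near_equilateral_def by blast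
    then have err: "cmod (w - x - \<sigma> * (p - x)) \<le> slack * D"
      using p(1) e by (meson mult_left_mono order_trans less_imp_le)
    show ?thesis
    proof (cases "\<sigma> = rot60")
      case True
      have "cmod (p - (x + cnj rot60 * (y - x))) \<le> D + slack * D"
        using turn_back[OF err w(1)] True inv by simp
      then show ?thesis by (simp add: z'_def v_def cnj_rot60 algebra_simps)
    next
      case False
      then have "cmod (p - (x + rot60 * (z0 - x))) \<le> ?s + slack * D"
        using turn_back[OF err to_z0[OF w(2)]] \<sigma> inv by simp
      moreover have "x + rot60 * (z0 - x) = y'"
        unfolding z0_def y'_def v_def using rot60_sq by algebra
      ultimately show ?thesis by (simp add: algebra_simps)
    qed
  qed
  have fy: "cmod (p - z') \<le> ?s \<or> cmod (p - x') \<le> ?t"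
  proof -
    obtain w \<sigma> where w: "cmod (w - x) \<le> D" "cmod (w - z) \<le> D" and \<sigma>: "\<sigma> \<in> {rot60, cnj rot60}"
      and "cmod (w - y - \<sigma> * (p - y)) \<le> slack * cmod (p - y)"
      using cov[of y] False unfolding near_equilateral_def by blast
    then have err: "cmod (w - y - \<sigma> * (p - y)) \<le> slack * D"
      using p(2) e by (meson mult_left_mono order_trans less_imp_le)
    show ?thesis
    proof (cases "\<sigma> = rot60")
      case True
      have "cmod (p - (y + cnj rot60 * (z0 - y))) \<le> ?s + slack * D"
        using turn_back[OF err to_z0[OF w(2)]] True inv by simp
      moreover have "y + cnj rot60 * (z0 - y) = x'"
        unfolding z0_def x'_def v_def cnj_rot60 using rot60_sq by algebra
      ultimately show ?thesis by (simp add: algebra_simps)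
    next
      case False
      then have "cmod (p - (y + rot60 * (x - y))) \<le> D + slack * D"
        using turn_back[OF err w(1)] \<sigma> inv by simp
      moreover have "y + rot60 * (x - y) = z'" by (simp add: z'_def v_def algebra_simps)
      ultimately show ?thesis by (simp add: algebra_simps)
    qed
  qed
  have fz: "cmod (p - y') \<le> ?t \<or> cmod (p - x') \<le> ?t"
  proof -
    obtain w \<sigma> where w: "cmod (w - x) \<le> D" "cmod (w - y) \<le> D" and \<sigma>: "\<sigma> \<in> {rot60, cnj rot60}"
      and "cmod (w - z - \<sigma> * (p - z)) \<le> slack * cmod (p - z)"
      using cov[of z] False unfolding near_equilateral_def by blast
    then have err: "cmod (w - z - \<sigma> * (p - z)) \<le> slack * D"
      using p(3) e by (meson mult_left_mono order_trans less_imp_le)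
    have "w - z0 - \<sigma> * (p - z0) = (w - z - \<sigma> * (p - z)) + (1 - \<sigma>) * (z - z0)"
      by (simp add: algebra_simps)
    then have "cmod (w - z0 - \<sigma> * (p - z0)) \<le> cmod (w - z - \<sigma> * (p - z)) + cmod ((1 - \<sigma>) * (z - z0))"
      by (metis norm_triangle_ineq)
    then have err0: "cmod (w - z0 - \<sigma> * (p - z0)) \<le> 2 * slack * D"
      using err z cmod_rotated(2)[OF \<sigma>] by (simp add: norm_mult)
    show ?thesis
    proof (cases "\<sigma> = rot60")
      case True
      have "cmod (p - (z0 + cnj rot60 * (x - z0))) \<le> D + 2 * slack * D"
        using turn_back[OF err0 w(1)] True inv by simp
      moreover have "z0 + cnj rot60 * (x - z0) = y'"
        unfolding z0_def y'_def v_def cnj_rot60 using rot60_sq by algebra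
      ultimately show ?thesis by (simp add: algebra_simps)
    next
      case False
      then have "cmod (p - (z0 + rot60 * (y - z0))) \<le> D + 2 * slack * D"
        using turn_back[OF err0 w(2)] \<sigma> inv by simp
      moreover have "z0 + rot60 * (y - z0) = x'"
        unfolding z0_def x'_def v_def using rot60_sq by algebra
      ultimately show ?thesis by (simp add: algebra_simps)
    qed
  qed
  have sqrt_bound: "cmod d \<le> r * D" if "2 * (cmod d)\<^sup>2 + 2 * D\<^sup>2 \<le> a\<^sup>2 + b\<^sup>2" "a\<^sup>2 + b\<^sup>2 \<le> 2 * (r * D)\<^sup>2 + 2 * D\<^sup>2" "r \<ge> 0"
    for d a b r
  proof (rule power2_le_imp_le)
    show "(cmod d)\<^sup>2 \<le> (r * D)\<^sup>2" using that by linarith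
  qed (use that D0 in simp)
  \<comment> \<open>The cluster radii: \<open>3 * slack + 5/2 * slack\<^sup>2 \<le> 0.294\<^sup>2\<close> and \<open>4 * slack + 4 * slack\<^sup>2 \<le> 0.34\<^sup>2\<close>.\<close>
  have num1: "?t\<^sup>2 + ?s\<^sup>2 \<le> 2 * (294 / 1000 * D)\<^sup>2 + 2 * D\<^sup>2"
    by (simp add: slack_def power2_eq_square algebra_simps)
  have num2: "?t\<^sup>2 + ?t\<^sup>2 \<le> 2 * (34 / 100 * D)\<^sup>2 + 2 * D\<^sup>2"
    by (simp add: slack_def power2_eq_square algebra_simps)
  have near_x: ?thesis if "cmod (p - y') \<le> ?t" "cmod (p - z') \<le> ?s"
  proof -
    have "cmod (p - x) \<le> 294 / 1000 * D"
    proof (rule sqrt_bound[OF parallelogram_bound num1])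
      show "cmod (p - (x + (rot60 - 1) * v)) \<le> ?t" using that by (simp add: y'_def)
      have "x - (rot60 - 1) * v = z'" by (simp add: z'_def algebra_simps)
      then show "cmod (p - (x - (rot60 - 1) * v)) \<le> ?s" using that by simp
      show "cmod ((rot60 - 1) * v) = D" using D by (simp add: norm_mult norm_minus_commute[of rot60 1])
    qed simp
    then show ?thesis by blast
  qed
  have near_y: ?thesis if "cmod (p - x') \<le> ?t" "cmod (p - z') \<le> ?s"
  proof -
    have "cmod (p - y) \<le> 294 / 1000 * D"
    proof (rule sqrt_bound[OF parallelogram_bound num1])
      have "y + rot60 * v = x'" by (simp add: x'_def v_def algebra_simps)
      then show "cmod (p - (y + rot60 * v)) \<le> ?t" using that by simp
      have "y - rot60 * v = z'" by (simp add: z'_def v_def algebra_simps)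
      then show "cmod (p - (y - rot60 * v)) \<le> ?s" using that by simp
      show "cmod (rot60 * v) = D" using D by (simp add: norm_mult)
    qed simp
    then show ?thesis by blast
  qed
  have near_z: ?thesis if "cmod (p - x') \<le> ?t" "cmod (p - y') \<le> ?t"
  proof -
    have "cmod (p - z0) \<le> 34 / 100 * D"
    proof (rule sqrt_bound[OF parallelogram_bound num2])
      have "z0 + v = x'" by (simp add: x'_def z0_def v_def algebra_simps)
      then show "cmod (p - (z0 + v)) \<le> ?t" using that by simp
      have "z0 - v = y'" by (simp add: y'_def z0_def v_def algebra_simps)
      then show "cmod (p - (z0 - v)) \<le> ?t" using that by simp
    qed (use D in simp_all)
    then show ?thesis by blast
  qed
  show ?thesis using fx fy fz near_x near_y near_z by blast
qed

text \<open>For an exact equilateral triangle, \<open>q - c = (1 - \<sigma>) * (p - c) + \<sigma> * (p' - c)\<close> with both factors of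
  modulus one. So a triangle with two vertices in a cluster cannot reach another cluster.\<close>

lemma cluster_escape:
  fixes c p p' q :: complex
  assumes "near_equilateral p p' q" "cmod (p - c) \<le> r" "cmod (p' - c) \<le> r"
  shows "cmod (q - c) \<le> 2 * (1 + slack) * r"
proof -
  obtain \<sigma> where \<sigma>: "\<sigma> \<in> {rot60, cnj rot60}" and err: "cmod (q - p - \<sigma> * (p' - p)) \<le> slack * cmod (p' - p)"
    using assms(1) unfolding near_equilateral_def by blast
  have "cmod (p' - p) \<le> cmod (p' - c) + cmod (p - c)"
    using norm_triangle_ineq4[of "p' - c" "p - c"] by simp
  then have "cmod (p' - p) \<le> 2 * r" using assms by simp
  then have err: "cmod (q - p - \<sigma> * (p' - p)) \<le> slack * (2 * r)"
    using err by (smt (verit) mult_left_mono slack_def divide_nonneg_nonneg)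
  have "q - c = (q - p - \<sigma> * (p' - p)) + ((1 - \<sigma>) * (p - c) + \<sigma> * (p' - c))"
    by (simp add: algebra_simps)
  then have "cmod (q - c) \<le> cmod (q - p - \<sigma> * (p' - p)) + cmod ((1 - \<sigma>) * (p - c) + \<sigma> * (p' - c))"
    by (metis norm_triangle_ineq)
  also have "cmod ((1 - \<sigma>) * (p - c) + \<sigma> * (p' - c)) \<le> cmod (p - c) + cmod (p' - c)"
    using norm_triangle_ineq[of "(1 - \<sigma>) * (p - c)" "\<sigma> * (p' - c)"] cmod_rotated[OF \<sigma>] by (simp add: norm_mult)
  finally show ?thesis using err assms by (simp add: algebra_simps)
qed

definition near_equilateral_set :: "complex set \<Rightarrow> bool" where
  "near_equilateral_set S \<longleftrightarrow> card S = 3 \<and> (\<forall>x y z. S = {x, y, z} \<longrightarrow> near_equilateral x y z)"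

text \<open>The three clusters are the points near \<open>x\<close>, \<open>y\<close> and \<open>z0\<close>. They exhaust the set by
  \<open>covered_point_near_vertex\<close> and are disjoint, and by \<open>cluster_escape\<close> a triangle with two vertices in the same
  cluster lies inside it.\<close>

lemma pair_covering_set_splits:
  fixes Q :: "complex set"
  assumes fin: "finite Q" and two: "card Q \<ge> 2"
    and cov: "covers_pairs near_equilateral_set Q"
  shows "\<exists>A B C. Q = A \<union> B \<union> C \<and> A \<noteq> {} \<and> B \<noteq> {} \<and> C \<noteq> {} \<and> splits near_equilateral_set A B C"
proof -
  have third: "\<exists>w\<in>Q. near_equilateral p q w" if pq: "p \<in> Q" "q \<in> Q" "p \<noteq> q" for p q
  proof -
    obtain S where S: "S \<subseteq> Q" "near_equilateral_set S" "p \<in> S" "q \<in> S" using cov pq unfolding covers_pairs_def by blast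
    then have "card (S - {p, q}) = 1" using pq by (simp add: near_equilateral_set_def card_Diff_subset)
    then obtain w where "S - {p, q} = {w}" using card_1_singletonE by blast
    then have "S = {p, q, w}" using S by blast
    then show ?thesis using S unfolding near_equilateral_set_def by blast
  qed
  define D where "D = Max ((\<lambda>(p, q). cmod (q - p)) ` (Q \<times> Q))"
  have ne: "Q \<noteq> {}" using two by auto
  have D_max: "cmod (q - p) \<le> D" if "p \<in> Q" "q \<in> Q" for p q
    unfolding D_def using that fin by (intro Max_ge) auto
  have "D \<in> (\<lambda>(p, q). cmod (q - p)) ` (Q \<times> Q)"
    unfolding D_def using fin ne by (intro Max_in) auto
  then obtain x1 y1 where xy1: "x1 \<in> Q" "y1 \<in> Q" "cmod (y1 - x1) = D" by auto
  have D0: "D > 0"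
  proof -
    obtain p q where "p \<in> Q" "q \<in> Q" "p \<noteq> q"
      by (metis card_le_Suc0_iff_eq fin not_less_eq_eq numeral_2_eq_2 two)
    then show ?thesis using D_max[of p q] by (smt (verit) right_minus_eq zero_less_norm_iff)
  qed
  have "x1 \<noteq> y1" using xy1 D0 by auto
  then obtain z where z: "z \<in> Q" "near_equilateral x1 y1 z" using third xy1 by blast
  \<comment> \<open>Name the endpoints of the diameter so that the third vertex lies on the positive side.\<close>
  obtain x y where xy: "x \<in> Q" "y \<in> Q" "cmod (y - x) = D" "cmod (z - x - rot60 * (y - x)) \<le> slack * D"
    using z(2) xy1 near_equilateral_swap[of z x1 y1] unfolding near_equilateral_def
    by (metis insertE norm_minus_commute singletonD)
  define z0 where "z0 = x + rot60 * (y - x)"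
  have zz0: "cmod (z - z0) \<le> slack * D" using xy(4) by (simp add: z0_def algebra_simps)
  have dists: "cmod (x - y) = D" "cmod (x - z0) = D" "cmod (y - z0) = D"
  proof -
    show "cmod (x - y) = D" using xy by (simp add: norm_minus_commute)
    show "cmod (x - z0) = D" using xy by (simp add: z0_def norm_mult)
    have "y - z0 = (1 - rot60) * (y - x)" by (simp add: z0_def algebra_simps)
    then show "cmod (y - z0) = D" using xy by (simp add: norm_mult)
  qed
  have dists': "cmod (y - x) = D" "cmod (z0 - x) = D" "cmod (z0 - y) = D"
    using dists by (simp_all add: norm_minus_commute)
  define A B C where "A = {p \<in> Q. cmod (p - x) \<le> 294/1000 * D}" and "B = {p \<in> Q. cmod (p - y) \<le> 294/1000 * D}"
    and "C = {p \<in> Q. cmod (p - z0) \<le> 34/100 * D}"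
  have "p \<in> A \<union> B \<union> C" if p: "p \<in> Q" for p
  proof -
    have "cmod (p - x) \<le> 294 / 1000 * D \<or> cmod (p - y) \<le> 294 / 1000 * D \<or> cmod (p - (x + rot60 * (y - x))) \<le> 34 / 100 * D"
    proof (rule covered_point_near_vertex[of y x D z p])
      show "cmod (z - (x + rot60 * (y - x))) \<le> slack * D" using zz0 by (simp add: z0_def)
      show "\<exists>w. near_equilateral q p w \<and> cmod (w - x) \<le> D \<and> cmod (w - y) \<le> D \<and> cmod (w - z) \<le> D"
        if "q \<in> {x, y, z}" "p \<noteq> q" for q
      proof -
        have "q \<in> Q" using that xy z by auto
        then show ?thesis using third[of q p] that p D_max xy z by metis
      qed
    qed (use p D_max xy z in auto)
    then show ?thesis using p by (auto simp: A_def B_def C_def z0_def)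
  qed
  then have union: "Q = A \<union> B \<union> C" by (auto simp: A_def B_def C_def)
  have apart: False
    if "cmod (p - c) \<le> r * D" "cmod (p - c') \<le> r' * D" "cmod (c - c') = D" "r + r' < 1" for p c c' r r'
  proof -
    have "D \<le> (r + r') * D"
      using norm_triangle_ineq4[of "p - c'" "p - c"] that by (simp add: algebra_simps)
    then show False using that(4) D0 by simp
  qed
  have disj: "A \<inter> B = {}" "A \<inter> C = {}" "B \<inter> C = {}"
    using apart[OF _ _ dists(1)] apart[OF _ _ dists(2)] apart[OF _ _ dists(3)]
    unfolding A_def B_def C_def by fastforce+
  have nonempty: "x \<in> A" "y \<in> B" "z \<in> C"
    using xy z zz0 D0 by (auto simp: A_def B_def C_def slack_def)
  have noAA: "q \<in> A" if "p \<in> A" "p' \<in> A" "q \<in> Q" "near_equilateral p p' q" for p p' q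
  proof -
    have "cmod (q - x) \<le> 2 * (1 + slack) * (294/1000 * D)"
      using that by (intro cluster_escape[OF that(4)]) (auto simp: A_def)
    then have q: "cmod (q - x) \<le> 61/100 * D" using D0 by (simp add: slack_def)
    have "\<not> cmod (q - y) \<le> 294/1000 * D" "\<not> cmod (q - z0) \<le> 34/100 * D"
      using apart[OF q] dists dists' by fastforce+
    then show ?thesis using that(3) union unfolding A_def B_def C_def by blast
  qed
  have noBB: "q \<in> B" if "p \<in> B" "p' \<in> B" "q \<in> Q" "near_equilateral p p' q" for p p' q
  proof -
    have "cmod (q - y) \<le> 2 * (1 + slack) * (294/1000 * D)"
      using that by (intro cluster_escape[OF that(4)]) (auto simp: B_def)
    then have q: "cmod (q - y) \<le> 61/100 * D" using D0 by (simp add: slack_def)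
    have "\<not> cmod (q - x) \<le> 294/1000 * D" "\<not> cmod (q - z0) \<le> 34/100 * D"
      using apart[OF q] dists dists' by fastforce+
    then show ?thesis using that(3) union unfolding A_def B_def C_def by blast
  qed
  have noCC: "q \<in> C" if "p \<in> C" "p' \<in> C" "q \<in> Q" "near_equilateral p p' q" for p p' q
  proof -
    have "cmod (q - z0) \<le> 2 * (1 + slack) * (34/100 * D)"
      using that by (intro cluster_escape[OF that(4)]) (auto simp: C_def)
    then have q: "cmod (q - z0) \<le> 70/100 * D" using D0 by (simp add: slack_def)
    have "\<not> cmod (q - x) \<le> 294/1000 * D" "\<not> cmod (q - y) \<le> 294/1000 * D"
      using apart[OF q] dists dists' by fastforce+
    then show ?thesis using that(3) union unfolding A_def B_def C_def by blast
  qed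
  have "S \<subseteq> A \<or> S \<subseteq> B \<or> S \<subseteq> C \<or> (\<exists>a\<in>A. \<exists>b\<in>B. \<exists>c\<in>C. S = {a, b, c})" if S: "S \<subseteq> Q" "near_equilateral_set S" for S
  proof -
    obtain p q r where pqr: "S = {p, q, r}" using S by (auto simp: near_equilateral_set_def card_3_iff)
    have near: "near_equilateral p q r" "near_equilateral p r q" "near_equilateral q r p"
      using S(2) pqr unfolding near_equilateral_set_def by (metis insert_commute)+
    have Q: "p \<in> Q" "q \<in> Q" "r \<in> Q" using S pqr by auto
    show ?thesis
    proof (cases "\<exists>R\<in>{A, B, C}. (p \<in> R \<and> q \<in> R) \<or> (p \<in> R \<and> r \<in> R) \<or> (q \<in> R \<and> r \<in> R)")
      case True
      then show ?thesis using noAA noBB noCC near Q pqr by blast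
    next
      case False
      then show ?thesis using Q union pqr by (auto; blast)
    qed
  qed
  then have "splits near_equilateral_set A B C" using disj unfolding splits_def union by blast
  moreover have "A \<noteq> {}" "B \<noteq> {}" "C \<noteq> {}" using nonempty by auto
  ultimately show ?thesis using union by (intro exI[of _ A] exI[of _ B] exI[of _ C] conjI)
qed

section \<open>Angles and similarity in the plane\<close>

lemma inner_eq_vangle: "(A - B) \<bullet> (C - B) = norm (A - B) * norm (C - B) * cos (vangle A B C)"
proof (cases "A = B \<or> C = B")
  case False
  then have "norm (A - B) * norm (C - B) > 0" by simp
  moreover have "\<bar>(A - B) \<bullet> (C - B)\<bar> \<le> norm (A - B) * norm (C - B)" by (rule Cauchy_Schwarz_ineq2)
  ultimately have "\<bar>(A - B) \<bullet> (C - B) / (norm (A - B) * norm (C - B))\<bar> \<le> 1" by simp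
  then have "cos (vangle A B C) = (A - B) \<bullet> (C - B) / (norm (A - B) * norm (C - B))"
    unfolding vangle_def by (intro cos_arccos_abs)
  then show ?thesis using False by simp
qed auto

lemma vangle_commute: "vangle A B C = vangle C B A"
  by (simp add: vangle_def inner_commute mult.commute)

lemma equilateral_vangle:
  assumes "equilateral {A, B, C}"
  shows "vangle A B C = pi / 3"
proof -
  obtain s where s: "\<forall>x\<in>{A, B, C}. \<forall>y\<in>{A, B, C}. x \<noteq> y \<longrightarrow> dist x y = s" and "card {A, B, C} = 3"
    using assms by (auto simp: equilateral_def is_triangle_def)
  then have ne: "A \<noteq> B" "C \<noteq> B" "A \<noteq> C" by (auto simp: card_insert_if split: if_splits)
  then have n: "norm (A - B) = s" "norm (C - B) = s" "norm (A - C) = s" "s > 0"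
    using s by (auto simp: dist_norm norm_minus_commute)
  have "(A - B) \<bullet> (C - B) = ((norm (A - B))\<^sup>2 + (norm (C - B))\<^sup>2 - (norm ((A - B) - (C - B)))\<^sup>2) / 2"
    by (simp add: power2_norm_eq_inner inner_diff inner_commute)
  then have "(A - B) \<bullet> (C - B) / (norm (A - B) * norm (C - B)) = 1 / 2" using n by (simp add: power2_eq_square)
  then show ?thesis unfolding vangle_def by (simp only: arccos_one_half)
qed

lemma vangle_homothety: "\<delta> > 0 \<Longrightarrow> vangle (v + \<delta> *\<^sub>R A) (v + \<delta> *\<^sub>R B) (v + \<delta> *\<^sub>R C) = vangle A B C"
  by (simp add: vangle_def scaleR_diff_right[symmetric])

lemma collinear_iff_inner:
  fixes x y z :: "'a::euclidean_space"
  shows "collinear {x, y, z} \<longleftrightarrow> \<bar>(x - y) \<bullet> (z - y)\<bar> = norm (x - y) * norm (z - y)"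
  unfolding norm_cauchy_schwarz_equal by (rule collinear_3) (simp add: NO_MATCH_def)

lemma is_triangle_homothety:
  assumes "\<delta> > 0" "is_triangle S"
  shows "is_triangle ((\<lambda>q. v + \<delta> *\<^sub>R q) ` S)"
proof -
  let ?f = "\<lambda>q::real^2. v + \<delta> *\<^sub>R q"
  obtain A B C where S: "S = {A, B, C}" "card S = 3"
    using assms(2) unfolding is_triangle_def card_3_iff by metis
  have "inj_on ?f S" using assms by (auto intro: inj_onI)
  moreover have "\<not> collinear (?f ` S)"
    using assms unfolding S image_insert image_empty collinear_iff_inner is_triangle_def
    by (simp add: scaleR_diff_right[symmetric] abs_mult)
  moreover have "card (?f ` S) = 3" using calculation(1) S(2) by (simp only: card_image)
  ultimately show ?thesis by (simp only: is_triangle_def simp_thms)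
qed

lemma eps_similar_homothety:
  assumes "\<delta> > 0" "eps_similar \<epsilon> S T"
  shows "eps_similar \<epsilon> ((\<lambda>q. v + \<delta> *\<^sub>R q) ` S) T"
proof -
  let ?f = "\<lambda>q::real^2. v + \<delta> *\<^sub>R q"
  obtain A B C A' B' C' where *: "T = {A, B, C}" "S = {A', B', C'}"
        "\<bar>vangle B A C - vangle B' A' C'\<bar> < \<epsilon>"
        "\<bar>vangle A B C - vangle A' B' C'\<bar> < \<epsilon>"
        "\<bar>vangle A C B - vangle A' C' B'\<bar> < \<epsilon>"
    and T: "is_triangle S" "is_triangle T" using assms unfolding eps_similar_def by blast
  have "is_triangle (?f ` S)" using T(1) by (rule is_triangle_homothety[OF assms(1)])
  moreover have "?f ` S = {?f A', ?f B', ?f C'}" using *(2) by simp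
  ultimately show ?thesis
    unfolding eps_similar_def using T * vangle_homothety[OF assms(1), of v] by metis
qed

lemma eventually_vangle_close:
  assumes "\<epsilon> > 0" "\<not> collinear {A, B, C}"
  shows "eventually (\<lambda>\<delta>. \<bar>vangle A B C - vangle (A + \<delta> *\<^sub>R a) (B + \<delta> *\<^sub>R b) (C + \<delta> *\<^sub>R c)\<bar> < \<epsilon>) (at_right 0)"
proof -
  let ?u = "\<lambda>\<delta>. (A + \<delta> *\<^sub>R a) - (B + \<delta> *\<^sub>R b)" and ?w = "\<lambda>\<delta>. (C + \<delta> *\<^sub>R c) - (B + \<delta> *\<^sub>R b)"
  have "\<bar>(A - B) \<bullet> (C - B)\<bar> \<noteq> norm (A - B) * norm (C - B)"
    using assms(2) by (simp add: collinear_iff_inner)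
  then have lt: "\<bar>(A - B) \<bullet> (C - B)\<bar> < norm (A - B) * norm (C - B)"
    using Cauchy_Schwarz_ineq2[of "A - B" "C - B"] by linarith
  then have pos: "norm (A - B) * norm (C - B) > 0" by linarith
  have "\<bar>(A - B) \<bullet> (C - B) / (norm (A - B) * norm (C - B))\<bar> < 1"
    using lt pos by simp
  then have cont: "isCont arccos ((A - B) \<bullet> (C - B) / (norm (A - B) * norm (C - B)))"
    by (intro isCont_arccos) (simp_all only: abs_less_iff, linarith+)
  have u: "(?u \<longlongrightarrow> A - B) (at_right 0)" and w: "(?w \<longlongrightarrow> C - B) (at_right 0)"
    by (auto intro!: tendsto_eq_intros)
  have "((\<lambda>\<delta>. ?u \<delta> \<bullet> ?w \<delta> / (norm (?u \<delta>) * norm (?w \<delta>))) \<longlongrightarrow>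
      (A - B) \<bullet> (C - B) / (norm (A - B) * norm (C - B))) (at_right 0)"
    using pos by (intro tendsto_intros u w) auto
  then have "((\<lambda>\<delta>. vangle (A + \<delta> *\<^sub>R a) (B + \<delta> *\<^sub>R b) (C + \<delta> *\<^sub>R c)) \<longlongrightarrow> vangle A B C) (at_right 0)"
    unfolding vangle_def by (rule isCont_tendsto_compose[OF cont])
  then show ?thesis
    using assms(1) by (auto dest!: tendstoD simp: dist_real_def abs_minus_commute)
qed

lemma eventually_noncollinear:
  assumes "\<not> collinear {A, B, C :: real^2}"
  shows "eventually (\<lambda>\<delta>. \<not> collinear {A + \<delta> *\<^sub>R a, B + \<delta> *\<^sub>R b, C + \<delta> *\<^sub>R c}) (at_right 0)"
proof -
  let ?u = "\<lambda>\<delta>. (A + \<delta> *\<^sub>R a) - (B + \<delta> *\<^sub>R b)" and ?w = "\<lambda>\<delta>. (C + \<delta> *\<^sub>R c) - (B + \<delta> *\<^sub>R b)"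
  have u: "(?u \<longlongrightarrow> A - B) (at_right 0)" and w: "(?w \<longlongrightarrow> C - B) (at_right 0)"
    by (auto intro!: tendsto_eq_intros)
  have "((\<lambda>\<delta>. norm (?u \<delta>) * norm (?w \<delta>) - \<bar>?u \<delta> \<bullet> ?w \<delta>\<bar>) \<longlongrightarrow>
     norm (A - B) * norm (C - B) - \<bar>(A - B) \<bullet> (C - B)\<bar>) (at_right 0)"
    by (intro tendsto_intros u w)
  moreover have "norm (A - B) * norm (C - B) - \<bar>(A - B) \<bullet> (C - B)\<bar> > 0"
    using assms Cauchy_Schwarz_ineq2[of "A - B" "C - B"] unfolding collinear_iff_inner by linarith
  ultimately have "eventually (\<lambda>\<delta>. norm (?u \<delta>) * norm (?w \<delta>) - \<bar>?u \<delta> \<bullet> ?w \<delta>\<bar> > 0) (at_right 0)"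
    by (rule order_tendstoD)
  then show ?thesis by eventually_elim (simp add: collinear_iff_inner)
qed

lemma eventually_eps_similar:
  assumes "is_triangle {A, B, C}" "\<epsilon> > 0"
  shows "eventually (\<lambda>\<delta>. eps_similar \<epsilon> {A + \<delta> *\<^sub>R a, B + \<delta> *\<^sub>R b, C + \<delta> *\<^sub>R c} {A, B, C}) (at_right 0)"
proof -
  have nc: "\<not> collinear {A, B, C}" using assms by (simp add: is_triangle_def)
  then have nc': "\<not> collinear {B, A, C}" "\<not> collinear {A, C, B}" by (simp_all add: insert_commute)
  show ?thesis
    using eventually_noncollinear[OF nc, of a b c] eventually_vangle_close[OF assms(2) nc, of a b c]
      eventually_vangle_close[OF assms(2) nc'(1), of b a c] eventually_vangle_close[OF assms(2) nc'(2), of a c b]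
  proof eventually_elim
    case (elim \<delta>)
    have "is_triangle {A + \<delta> *\<^sub>R a, B + \<delta> *\<^sub>R b, C + \<delta> *\<^sub>R c}"
      using elim(1) by (auto simp: is_triangle_def card_insert_if insert_commute collinear_2 dest: arg_cong)
    then show ?case unfolding eps_similar_def using assms(1) elim(2-4) by blast
  qed
qed

section \<open>The recursive construction\<close>

lemma num_similar_Un3:
  assumes fin: "finite P" "finite Q" "finite R" and disj: "P \<inter> Q = {}" "P \<inter> R = {}" "Q \<inter> R = {}"
    and cross: "\<And>p q r. p \<in> P \<Longrightarrow> q \<in> Q \<Longrightarrow> r \<in> R \<Longrightarrow> eps_similar \<epsilon> {p, q, r} T"
  shows "card P * card Q * card R + num_similar P T \<epsilon> + num_similar Q T \<epsilon> + num_similar R T \<epsilon>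
    \<le> num_similar (P \<union> Q \<union> R) T \<epsilon>"
proof -
  let ?in = "\<lambda>P. {S. S \<subseteq> P \<and> eps_similar \<epsilon> S T}" and ?t = "\<lambda>(a, b, c). {a, b, c}"
  let ?X = "?t ` (P \<times> Q \<times> R)"
  have ne: "S \<noteq> {}" if "eps_similar \<epsilon> S T" for S using that by (auto simp: eps_similar_def)
  have "inj_on ?t (P \<times> Q \<times> R)"
  proof (rule inj_onI, clarsimp)
    fix a b c a' b' c'
    assume *: "a \<in> P" "b \<in> Q" "c \<in> R" "a' \<in> P" "b' \<in> Q" "c' \<in> R" and eq: "{a, b, c} = {a', b', c'}"
    have "{a, b, c} \<inter> P = {a', b', c'} \<inter> P" "{a, b, c} \<inter> Q = {a', b', c'} \<inter> Q" "{a, b, c} \<inter> R = {a', b', c'} \<inter> R"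
      using eq by simp_all
    moreover have "{a, b, c} \<inter> P = {a}" "{a', b', c'} \<inter> P = {a'}" "{a, b, c} \<inter> Q = {b}" "{a', b', c'} \<inter> Q = {b'}"
      "{a, b, c} \<inter> R = {c}" "{a', b', c'} \<inter> R = {c'}" using * disj by auto
    ultimately show "a = a' \<and> b = b' \<and> c = c'" by simp
  qed
  then have X: "card ?X = card P * card Q * card R"
    by (simp add: card_image card_cartesian_product)
  have f: "finite ?X" "finite (?in P)" "finite (?in Q)" "finite (?in R)" using fin by auto
  have d1: "?X \<inter> ?in P = {}" "(?X \<union> ?in P) \<inter> ?in Q = {}" "(?X \<union> ?in P \<union> ?in Q) \<inter> ?in R = {}"
    using disj ne by (auto; blast)+
  have "card (?X \<union> ?in P \<union> ?in Q \<union> ?in R) = card ?X + card (?in P) + card (?in Q) + card (?in R)"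
    using f d1 by (simp add: card_Un_disjoint)
  moreover have "card (?X \<union> ?in P \<union> ?in Q \<union> ?in R) \<le> num_similar (P \<union> Q \<union> R) T \<epsilon>"
    unfolding num_similar_def using fin cross by (intro card_mono) auto
  ultimately show ?thesis using X by (simp add: num_similar_def)
qed

lemma num_similar_homothety:
  assumes "\<delta> > 0" "finite P"
  shows "num_similar P T \<epsilon> \<le> num_similar ((\<lambda>q. v + \<delta> *\<^sub>R q) ` P) T \<epsilon>"
  unfolding num_similar_def
proof (rule card_inj_on_le)
  let ?f = "\<lambda>q::real^2. v + \<delta> *\<^sub>R q"
  have "inj ?f" using assms by (auto intro: injI)
  then show "inj_on ((`) ?f) {S. S \<subseteq> P \<and> eps_similar \<epsilon> S T}"
    by (meson inj_image_eq_iff inj_onI)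
  show "(`) ?f ` {S. S \<subseteq> P \<and> eps_similar \<epsilon> S T} \<subseteq> {S. S \<subseteq> ?f ` P \<and> eps_similar \<epsilon> S T}"
    using eps_similar_homothety[OF assms(1)] by blast
qed (use assms in auto)

text \<open>Small homothetic copies of sets for \<open>a\<close>, \<open>b\<close>, \<open>c\<close> points are placed at the vertices of \<open>T\<close>. Homotheties
  keep the similar triangles inside the copies, and since angles are continuous at a nondegenerate
  triangle, every choice of one point from each copy is \<open>\<epsilon>\<close>-similar to \<open>T\<close> when the copies are small enough.\<close>

lemma h_rec_le_num_similar:
  assumes T: "is_triangle T" and eps: "\<epsilon> > 0"
  shows "\<exists>P. finite P \<and> card P = n \<and> h_rec n \<le> num_similar P T \<epsilon>"
proof (induction n rule: less_induct)
  case (less n)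
  show ?case
  proof (cases "n \<le> 2")
    case True
    then have "h_rec n = 0" by (simp add: h_rec.simps)
    moreover have "\<exists>P :: (real^2) set. finite P \<and> card P = n"
      using h_sim_wf(2)[of T \<epsilon> n] by blast
    ultimately show ?thesis by auto
  next
    case False
    then obtain a b c where abc: "a + b + c = n" "a < n" "b < n" "c < n"
      and h: "h_rec n = a * b * c + h_rec a + h_rec b + h_rec c"
      using h_rec_obtain[of n] by auto
    obtain P Q R where P: "finite P" "card P = a" "h_rec a \<le> num_similar P T \<epsilon>"
      and Q: "finite Q" "card Q = b" "h_rec b \<le> num_similar Q T \<epsilon>"
      and R: "finite R" "card R = c" "h_rec c \<le> num_similar R T \<epsilon>"
      using less.IH abc by metis
    obtain A B C where ABC: "T = {A, B, C}" and ne: "A \<noteq> B" "A \<noteq> C" "B \<noteq> C"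
      using T by (auto simp: is_triangle_def card_3_iff)
    let ?f = "\<lambda>\<delta> v q. v + \<delta> *\<^sub>R (q :: real^2)"
    have away: "eventually (\<lambda>\<delta>. ?f \<delta> v p \<noteq> ?f \<delta> w q) (at_right 0)" if "v \<noteq> w" for v w p q
    proof -
      have "((\<lambda>\<delta>. ?f \<delta> v p - ?f \<delta> w q) \<longlongrightarrow> v - w) (at_right 0)" by (auto intro!: tendsto_eq_intros)
      then have "eventually (\<lambda>\<delta>. ?f \<delta> v p - ?f \<delta> w q \<noteq> 0) (at_right 0)"
        using that by (intro tendsto_imp_eventually_ne) auto
      then show ?thesis by eventually_elim auto
    qed
    have "eventually (\<lambda>\<delta>. \<delta> > 0 \<and>
       (\<forall>p\<in>P. \<forall>q\<in>Q. \<forall>r\<in>R. eps_similar \<epsilon> {?f \<delta> A p, ?f \<delta> B q, ?f \<delta> C r} T) \<and>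
       (\<forall>p\<in>P. \<forall>q\<in>Q. ?f \<delta> A p \<noteq> ?f \<delta> B q) \<and> (\<forall>p\<in>P. \<forall>r\<in>R. ?f \<delta> A p \<noteq> ?f \<delta> C r) \<and>
       (\<forall>q\<in>Q. \<forall>r\<in>R. ?f \<delta> B q \<noteq> ?f \<delta> C r)) (at_right (0::real))"
    proof (intro eventually_conj eventually_ball_finite ballI P(1) Q(1) R(1) away ne eventually_at_right_less)
      show "eventually (\<lambda>\<delta>. eps_similar \<epsilon> {?f \<delta> A p, ?f \<delta> B q, ?f \<delta> C r} T) (at_right 0)" for p q r
        unfolding ABC using T eps by (intro eventually_eps_similar) (simp_all add: ABC)
    qed
    then obtain \<delta> :: real where \<delta>: "\<delta> > 0"
       "\<forall>p\<in>P. \<forall>q\<in>Q. \<forall>r\<in>R. eps_similar \<epsilon> {?f \<delta> A p, ?f \<delta> B q, ?f \<delta> C r} T"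
       "\<forall>p\<in>P. \<forall>q\<in>Q. ?f \<delta> A p \<noteq> ?f \<delta> B q" "\<forall>p\<in>P. \<forall>r\<in>R. ?f \<delta> A p \<noteq> ?f \<delta> C r"
       "\<forall>q\<in>Q. \<forall>r\<in>R. ?f \<delta> B q \<noteq> ?f \<delta> C r"
      using eventually_happens'[OF trivial_limit_at_right_real] by blast
    let ?P = "?f \<delta> A ` P" and ?Q = "?f \<delta> B ` Q" and ?R = "?f \<delta> C ` R"
    have inj: "inj_on (?f \<delta> v) X" for v X using \<delta>(1) by (auto intro: inj_onI)
    have disj: "?P \<inter> ?Q = {}" "?P \<inter> ?R = {}" "?Q \<inter> ?R = {}" using \<delta>(3-5) by blast+
    have cards: "card ?P = a" "card ?Q = b" "card ?R = c" using P Q R by (simp_all add: card_image inj)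
    have "card ?P * card ?Q * card ?R + num_similar ?P T \<epsilon> + num_similar ?Q T \<epsilon> + num_similar ?R T \<epsilon>
      \<le> num_similar (?P \<union> ?Q \<union> ?R) T \<epsilon>"
      using \<delta>(2) P Q R disj by (intro num_similar_Un3) auto
    moreover have "num_similar P T \<epsilon> \<le> num_similar ?P T \<epsilon>" "num_similar Q T \<epsilon> \<le> num_similar ?Q T \<epsilon>"
      "num_similar R T \<epsilon> \<le> num_similar ?R T \<epsilon>"
      using \<delta>(1) P(1) Q(1) R(1) by (intro num_similar_homothety; simp)+
    ultimately have "h_rec n \<le> num_similar (?P \<union> ?Q \<union> ?R) T \<epsilon>"
      using P(3) Q(3) R(3) cards h by simp
    moreover have "card (?P \<union> ?Q \<union> ?R) = n"
      using P Q R disj cards abc(1) by (simp add: card_Un_disjoint Int_Un_distrib2)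
    ultimately show ?thesis using P(1) Q(1) R(1) by (intro exI[of _ "?P \<union> ?Q \<union> ?R"] conjI) simp_all
  qed
qed

section \<open>Counting almost equilateral triangles\<close>

definition to_complex :: "real^2 \<Rightarrow> complex" where
  "to_complex v = Complex (v $ 1) (v $ 2)"

lemma inj_to_complex: "inj to_complex"
  by (rule injI) (simp add: to_complex_def vec_eq_iff forall_2)

lemma to_complex_diff: "to_complex v - to_complex w = to_complex (v - w)"
  by (simp add: to_complex_def complex_eq_iff)

lemma inner_to_complex: "to_complex v \<bullet> to_complex w = v \<bullet> w"
  by (simp add: to_complex_def inner_complex_def inner_vec_def sum_2)

lemma norm_to_complex: "norm (to_complex v) = norm v"
  by (simp add: norm_eq_sqrt_inner inner_to_complex)

definition almost_equilateral :: "(real^2) set \<Rightarrow> bool" where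
  "almost_equilateral S \<longleftrightarrow> card S = 3 \<and> (\<forall>A B C. S = {A, B, C} \<longrightarrow> \<bar>vangle A B C - pi/3\<bar> < pi/180)"

lemma near_equilateral_set_to_complex:
  assumes "almost_equilateral S"
  shows "near_equilateral_set (to_complex ` S)"
  unfolding near_equilateral_set_def
proof (intro conjI allI impI)
  show "card (to_complex ` S) = 3"
    using assms inj_to_complex by (simp add: almost_equilateral_def card_image inj_on_subset)
  fix x y z assume xyz: "to_complex ` S = {x, y, z}"
  obtain A B C where x: "x = to_complex A" and y: "y = to_complex B" and z: "z = to_complex C"
    using xyz by (metis imageE insertCI)
  have "to_complex ` S = to_complex ` {A, B, C}" using xyz x y z by simp
  then have S: "S = {A, B, C}" using inj_to_complex by (simp only: inj_image_eq_iff)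
  have ang: "\<bar>vangle B A C - pi/3\<bar> < pi/180" "\<bar>vangle A B C - pi/3\<bar> < pi/180" "\<bar>vangle A C B - pi/3\<bar> < pi/180"
    using assms S unfolding almost_equilateral_def by (metis insert_commute)+
  have "card {A, B, C} = 3" using assms S by (simp add: almost_equilateral_def)
  then have "A \<noteq> B" "B \<noteq> C" "A \<noteq> C" by (auto simp: card_insert_if split: if_splits)
  then show "near_equilateral x y z"
    using ang unfolding x y z
    by (intro near_equilateral_if_angles[of _ _ _ "vangle B A C" "vangle A B C" "vangle A C B"])
      (simp_all only: to_complex_diff inner_to_complex norm_to_complex inner_eq_vangle inj_eq[OF inj_to_complex] not_False_eq_True)
qed

text \<open>The weighted bound with all weights one, where \<open>h_rec 1 = 0\<close>.\<close>

lemma almost_equilateral_count: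
  assumes "finite P"
  shows "card {S. S \<subseteq> P \<and> almost_equilateral S} \<le> h_rec (card P)"
proof -
  let ?Q = "to_complex ` P"
  have fin: "finite ?Q" using assms by simp
  have "card {S. S \<subseteq> P \<and> almost_equilateral S} \<le> card {S. S \<subseteq> ?Q \<and> near_equilateral_set S}"
  proof (rule card_inj_on_le)
    show "inj_on ((`) to_complex) {S. S \<subseteq> P \<and> almost_equilateral S}"
      using inj_to_complex by (meson inj_image_eq_iff inj_onI)
    show "(`) to_complex ` {S. S \<subseteq> P \<and> almost_equilateral S} \<subseteq> {S. S \<subseteq> ?Q \<and> near_equilateral_set S}"
      using near_equilateral_set_to_complex by blast
  qed (use fin in auto)
  also have "\<dots> = edge_weight near_equilateral_set ?Q (\<lambda>_. 1)" by (simp add: edge_weight_def)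
  also have "\<dots> + (\<Sum>x\<in>?Q. h_rec 1) \<le> h_rec (sum (\<lambda>_. 1) ?Q)"
    by (rule recursive_bound[OF _ pair_covering_set_splits fin]) (auto simp: near_equilateral_set_def)
  finally show ?thesis using inj_to_complex by (simp add: card_image inj_on_subset)
qed

lemma eps_similar_almost_equilateral:
  assumes sim: "eps_similar \<epsilon> S T" and eps: "\<epsilon> + \<eta> \<le> pi / 180"
    and T: "\<And>A B C. T = {A, B, C} \<Longrightarrow> \<bar>vangle A B C - pi / 3\<bar> \<le> \<eta>"
  shows "almost_equilateral S"
proof -
  obtain A B C A' B' C' where *: "T = {A, B, C}" "S = {A', B', C'}"
        "\<bar>vangle B A C - vangle B' A' C'\<bar> < \<epsilon>"
        "\<bar>vangle A B C - vangle A' B' C'\<bar> < \<epsilon>"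
        "\<bar>vangle A C B - vangle A' C' B'\<bar> < \<epsilon>"
    and card: "card S = 3" using sim unfolding eps_similar_def is_triangle_def by blast
  have "\<bar>vangle B A C - pi / 3\<bar> \<le> \<eta>" "\<bar>vangle A B C - pi / 3\<bar> \<le> \<eta>" "\<bar>vangle A C B - pi / 3\<bar> \<le> \<eta>"
    using *(1) by (auto intro!: T)
  then have a: "\<bar>vangle B' A' C' - pi/3\<bar> < pi/180" "\<bar>vangle A' B' C' - pi/3\<bar> < pi/180" "\<bar>vangle A' C' B' - pi/3\<bar> < pi/180"
    using *(3-5) eps by linarith+
  have "\<bar>vangle x y z - pi/3\<bar> < pi/180" if S: "S = {x, y, z}" for x y z
  proof -
    have ne: "x \<noteq> y" "y \<noteq> z" "x \<noteq> z" using card unfolding S by (auto simp: card_insert_if split: if_splits)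
    have "x \<in> {A', B', C'}" "y \<in> {A', B', C'}" "z \<in> {A', B', C'}" using S *(2) by auto
    then show ?thesis using ne a vangle_commute by auto
  qed
  then show ?thesis using card unfolding almost_equilateral_def by blast
qed

lemma h_sim_eq:
  assumes T: "is_triangle T" and eps: "\<epsilon> > 0"
    and almost: "\<And>S. eps_similar \<epsilon> S T \<Longrightarrow> almost_equilateral S"
  shows "h_sim n T \<epsilon> = h_rec n"
proof (rule antisym)
  have "num_similar P T \<epsilon> \<le> h_rec n" if "finite P" "card P = n" for P
  proof -
    have "num_similar P T \<epsilon> \<le> card {S. S \<subseteq> P \<and> almost_equilateral S}"
      unfolding num_similar_def using that almost by (intro card_mono) auto
    then show ?thesis using almost_equilateral_count[OF that(1)] that(2) by simp
  qed
  then show "h_sim n T \<epsilon> \<le> h_rec n"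
    unfolding h_sim_def using h_sim_wf by (subst Max_le_iff) auto
  obtain P where "finite P" "card P = n" "h_rec n \<le> num_similar P T \<epsilon>"
    using h_rec_le_num_similar[OF T eps] by blast
  then show "h_rec n \<le> h_sim n T \<epsilon>"
    unfolding h_sim_def using h_sim_wf by (subst Max_ge_iff) auto
qed

theorem theorem1p2:
  shows "\<exists>\<epsilon>0 \<ge> degrees 1.
    (\<forall>T0 \<epsilon> n. equilateral T0 \<and> 0 < \<epsilon> \<and> \<epsilon> < \<epsilon>0 \<longrightarrow> h_sim n T0 \<epsilon> = h_rec n) \<and>
    (\<forall>T \<epsilon>. is_triangle T \<and>
        triangle_angles T \<subseteq> {degrees 60 - \<epsilon>0 / 2 .. degrees 60 + \<epsilon>0 / 2} \<and>
        0 < \<epsilon> \<and> \<epsilon> < \<epsilon>0 / 2 \<longrightarrow>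
      (\<forall>n. h_sim n T \<epsilon> = h_rec n) \<and>
      (\<forall>n. (\<exists>k. n = 3 ^ k) \<longrightarrow> real (h_sim n T \<epsilon>) = (real n ^ 3 - real n) / 24))"
proof (rule exI[of _ "degrees 1"], intro conjI allI impI order_refl)
  fix T0 :: "(real^2) set" and \<epsilon> n
  assume *: "equilateral T0 \<and> 0 < \<epsilon> \<and> \<epsilon> < degrees 1"
  show "h_sim n T0 \<epsilon> = h_rec n"
  proof (rule h_sim_eq)
    show "almost_equilateral S" if "eps_similar \<epsilon> S T0" for S
      using that
    proof (rule eps_similar_almost_equilateral[where \<eta> = 0])
      show "\<bar>vangle A B C - pi / 3\<bar> \<le> 0" if "T0 = {A, B, C}" for A B C
        using * that equilateral_vangle by simp
    qed (use * in \<open>simp add: degrees_def\<close>)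
  qed (use * in \<open>auto simp: equilateral_def\<close>)
next
  fix T :: "(real^2) set" and \<epsilon>
  assume *: "is_triangle T \<and> triangle_angles T \<subseteq> {degrees 60 - degrees 1 / 2 .. degrees 60 + degrees 1 / 2} \<and>
        0 < \<epsilon> \<and> \<epsilon> < degrees 1 / 2"
  show h: "h_sim n T \<epsilon> = h_rec n" for n
  proof (rule h_sim_eq)
    show "almost_equilateral S" if "eps_similar \<epsilon> S T" for S
      using that
    proof (rule eps_similar_almost_equilateral[where \<eta> = "degrees 1 / 2"])
      show "\<bar>vangle A B C - pi / 3\<bar> \<le> degrees 1 / 2" if "T = {A, B, C}" for A B C
      proof -
        have "vangle A B C \<in> {degrees 60 - degrees 1 / 2 .. degrees 60 + degrees 1 / 2}"
          using * that unfolding triangle_angles_def by blast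
        then show ?thesis unfolding atLeastAtMost_iff degrees_def abs_le_iff by linarith
      qed
    qed (use * in \<open>simp add: degrees_def\<close>)
  qed (use * in auto)
  fix n :: nat assume "\<exists>k. n = 3 ^ k"
  then have "24 * h_rec n + n = n ^ 3" using h_rec_power3 by blast
  then have "24 * real (h_rec n) + real n = real n ^ 3" by (metis of_nat_add of_nat_mult of_nat_numeral of_nat_power)
  then show "real (h_sim n T \<epsilon>) = (real n ^ 3 - real n) / 24" unfolding h by simp
qed

end
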